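(* Let $d \ge 3$, let $P$ be a simplicial $d$-polytope, and let $V_\circ \sqcup V_\bullet$ be a partition of the vertex set of $P$ with $V_\circ \neq \varnothing \neq V_\bullet$. Put $v_\circ = |V_\circ|$, $v_\bullet = |V_\bullet|$ and $m = \min(d, v_\circ)$, and let $e_{\circ\bullet}$ be the number of edges of $P$ having one endpoint in $V_\circ$ and the other in $V_\bullet$. If $v_\bullet \ge d$, then $$e_{\circ\bullet} \ge \frac{m(2d+1-m)}{2}.$$
   Context: A polytope is the convex hull of finitely many points; its dimension is the dimension of its affine hull, and a $d$-polytope is a polytope of dimension $d$. Its faces are its intersections with its supporting hyperplanes, together with the polytope itself; vertices are $0$-dimensional faces and edges are $1$-dimensional faces. A polytope is simplicial when all its proper faces are simplices. *)

theory Defs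
  imports "HOL-Analysis.Analysis"
begin

(* Faces are those of the library predicate face_of.  For a polytope the nonempty ones are
   exactly the polytope itself and its intersections with supporting hyperplanes. *)
lemma face_of_polytope_iff_supporting_hyperplane:
  fixes P :: "'a::euclidean_space set"
  assumes P: "polytope P" and F: "F \<noteq> {}"
  shows "F face_of P \<longleftrightarrow>
    F = P \<or> (\<exists>a b. a \<noteq> 0 \<and> P \<subseteq> {x. a \<bullet> x \<le> b} \<and> F = P \<inter> {x. a \<bullet> x = b})"
proof
  assume "F face_of P"
  then have "F exposed_face_of P"
    using P by (simp add: exposed_face_of_polyhedron polytope_imp_polyhedron)
  then show "F = P \<or> (\<exists>a b. a \<noteq> 0 \<and> P \<subseteq> {x. a \<bullet> x \<le> b} \<and> F = P \<inter> {x. a \<bullet> x = b})"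
    using F unfolding exposed_face_of by blast
next
  assume "F = P \<or> (\<exists>a b. a \<noteq> 0 \<and> P \<subseteq> {x. a \<bullet> x \<le> b} \<and> F = P \<inter> {x. a \<bullet> x = b})"
  then show "F face_of P"
    using face_of_Int_supporting_hyperplane_le[OF polytope_imp_convex[OF P]]
      face_of_refl[OF polytope_imp_convex[OF P]] by blast
qed

definition vertices_of :: "'a::euclidean_space set \<Rightarrow> 'a set" where
  "vertices_of P = {v. {v} face_of P}"

(* The empty face is harmless here: it is a simplex of dimension -1. *)
definition simplicial_polytope :: "'a::euclidean_space set \<Rightarrow> bool" where
  "simplicial_polytope P \<longleftrightarrow>
     polytope P \<and> (\<forall>F. F face_of P \<and> F \<noteq> P \<longrightarrow> (\<exists>n. n simplex F))"

definition edges_between :: "'a::euclidean_space set \<Rightarrow> 'a set \<Rightarrow> 'a set \<Rightarrow> 'a set set" where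
  "edges_between P A B = {e. e edge_of P \<and> (\<exists>u\<in>A. \<exists>w\<in>B. e = closed_segment u w)}"

end

theory Submission
  imports Defs
begin

text \<open>
  The bound is a count of first-order motions.  Let \<open>L\<close> be the direction space of the affine hull
  of \<open>P\<close>, of dimension \<open>d\<close>, and give every vertex \<open>v\<close> a velocity \<open>a v \<in> L\<close>.  An edge \<open>u w\<close> keeps its
  length to first order iff \<open>(a u - a w) \<bullet> (u - w) = 0\<close>.  The velocities that keep all distances within
  a set of \<open>n\<close> points form a space of dimension at least \<open>\<Sum>i<min d n. d - i\<close>, in whatever position the
  points are (\<open>rigid_velocities_dim\<close>).  Moving the white and the black vertices in this way,
  independently of each other, gives a space of dimension at least
  \<open>(\<Sum>i<m. d - i) + (\<Sum>i<d. d - i)\<close>, because there are at least \<open>d\<close> black vertices.  Every white-black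
  edge imposes one linear equation, and pinning the \<open>d\<close> vertices of a facet costs \<open>\<Sum>i<d. d - i\<close> more
  (\<open>pin_simplex\<close>).  If there were fewer than \<open>\<Sum>i<m. d - i = m (2d + 1 - m) / 2\<close> white-black edges, a
  nonzero velocity field would be left that keeps all edge lengths and vanishes on a facet.  By the
  theorem of Dehn and Whiteley there is none: a simplicial \<open>d\<close>-polytope with \<open>d \<ge> 3\<close> is
  infinitesimally rigid (\<open>simplicial_rigidity\<close>).

  Rigidity is obtained from a maximum principle.  For \<open>d = 3\<close>, let \<open>a\<close> vanish on the facet \<open>F\<^sub>0\<close>
  and let \<open>z\<close> be a point that lies beyond \<open>F\<^sub>0\<close> and beneath all other facets.  Put \<open>f w = a w \<bullet> (z - w)\<close>.  Seen from \<open>z\<close>, the polytope becomes its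
  Schlegel diagram, in which the edges around every vertex outside \<open>F\<^sub>0\<close> positively span the plane.
  Around such a vertex \<open>v\<close>, each edge \<open>v w\<close> lies in exactly two triangles.  Weighting the rim edge
  \<open>w x\<close> of a triangle \<open>v w x\<close> by the reciprocal of an area makes the wheel around \<open>v\<close> carry an
  equilibrium stress with positive weights on the spokes (\<open>polygon_equilibrium\<close>).
  The contributions of the rim edges cancel, and what remains says that \<open>f / h\<close> at \<open>v\<close> is a weighted mean of its values at the
  neighbours of \<open>v\<close>, for a suitable positive affine function \<open>h\<close> with \<open>h z = 0\<close>
  (\<open>displacement_harmonic\<close>).  As \<open>f = 0\<close> on \<open>F\<^sub>0\<close>, it follows that \<open>f = 0\<close> everywhere; moving \<open>z\<close> a little
  gives \<open>a = 0\<close>.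

  For larger \<open>d\<close> the same argument works inside the star of a face \<open>\<sigma>\<close> with \<open>d - 3\<close> vertices, as the
  link of \<open>\<sigma>\<close> is the boundary of a simplicial 3-polytope.  Since vertex links are connected
  (\<open>link_connected\<close>, by the simplex method), vanishing spreads from such stars to the stars of smaller
  faces, and at last to the star of the empty face, which is the whole boundary (\<open>star_rigid\<close>).

  All of this uses a polytope only through its vertex set \<open>V\<close> and the subsets of \<open>V\<close> on which a
  nonnegative affine functional vanishes.
\<close>

section \<open>Affine functionals\<close>

text \<open>Faces, distances to facets and the components of velocities are all handled through functionals
  of this form; those that vanish on a face stand for functionals on the quotient by its span.\<close>

definition affine_functional :: "('a::euclidean_space \<Rightarrow> real) \<Rightarrow> bool" where
  "affine_functional \<phi> \<longleftrightarrow> (\<exists>u c. \<phi> = (\<lambda>x. u \<bullet> x + c))"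

lemma affine_functional_const: "affine_functional (\<lambda>x. c)"
  unfolding affine_functional_def by (rule exI[of _ 0], rule exI[of _ c]) simp

lemma affine_functional_inner: "affine_functional (\<lambda>x. u \<bullet> (x - v))"
  unfolding affine_functional_def
  by (rule exI[of _ u], rule exI[of _ "- (u \<bullet> v)"]) (simp add: inner_diff_right)

lemma affine_functional_add:
  assumes "affine_functional \<phi>" "affine_functional \<psi>"
  shows "affine_functional (\<lambda>x. \<phi> x + \<psi> x)"
proof -
  obtain u c u' c' where "\<phi> = (\<lambda>x. u \<bullet> x + c)" "\<psi> = (\<lambda>x. u' \<bullet> x + c')"
    using assms unfolding affine_functional_def by blast
  then show ?thesis
    unfolding affine_functional_def
    by (intro exI[of _ "u + u'"] exI[of _ "c + c'"]) (auto simp: inner_add_left)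
qed

lemma affine_functional_cmult:
  assumes "affine_functional \<phi>"
  shows "affine_functional (\<lambda>x. r * \<phi> x)"
proof -
  obtain u c where "\<phi> = (\<lambda>x. u \<bullet> x + c)"
    using assms unfolding affine_functional_def by blast
  then show ?thesis
    unfolding affine_functional_def
    by (intro exI[of _ "r *\<^sub>R u"] exI[of _ "r * c"]) (auto simp: algebra_simps)
qed

lemma affine_functional_diff:
  assumes "affine_functional \<phi>" "affine_functional \<psi>"
  shows "affine_functional (\<lambda>x. \<phi> x - \<psi> x)"
  using affine_functional_add[OF assms(1) affine_functional_cmult[OF assms(2), of "-1"]] by simp

lemma affine_functional_sum:
  assumes "affine_functional \<phi>" "sum r S = 1"
  shows "\<phi> (\<Sum>x\<in>S. r x *\<^sub>R x) = (\<Sum>x\<in>S. r x * \<phi> x)"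
proof -
  obtain u c where \<phi>: "\<phi> = (\<lambda>x. u \<bullet> x + c)"
    using assms unfolding affine_functional_def by blast
  have "(\<Sum>x\<in>S. r x * \<phi> x) = (\<Sum>x\<in>S. r x * (u \<bullet> x)) + (\<Sum>x\<in>S. r x) * c"
    by (simp add: \<phi> distrib_left sum.distrib sum_distrib_right)
  then show ?thesis
    by (simp add: \<phi> inner_sum_right assms(2))
qed

lemma affine_functional_continuous:
  assumes "affine_functional \<phi>"
  shows "continuous_on S \<phi>"
proof -
  obtain u c where \<phi>: "\<phi> = (\<lambda>x. u \<bullet> x + c)"
    using assms unfolding affine_functional_def by blast
  show ?thesis
    unfolding \<phi> by (intro continuous_intros)
qed

lemma affine_functional_vanishes_hull:
  assumes "affine_functional \<phi>" "\<And>x. x \<in> S \<Longrightarrow> \<phi> x = 0" "y \<in> affine hull S"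
  shows "\<phi> y = 0"
proof -
  obtain u c where \<phi>: "\<phi> = (\<lambda>x. u \<bullet> x + c)"
    using assms unfolding affine_functional_def by blast
  have "affine {x. u \<bullet> x = - c}"
    by (rule affine_hyperplane)
  moreover have "S \<subseteq> {x. u \<bullet> x = - c}"
    using assms(2) by (force simp: \<phi> )
  ultimately have "y \<in> {x. u \<bullet> x = - c}"
    using assms(3) hull_minimal by (metis subsetD)
  then show ?thesis by (simp add: \<phi>)
qed

text \<open>Split \<open>v - s\<close>, for some \<open>s \<in> S\<close>, into a part in the direction space of \<open>S\<close> and a nonzero part
  orthogonal to it; the latter is the normal vector.\<close>

lemma affine_functional_separating:
  fixes S :: "'a::euclidean_space set"
  assumes "v \<notin> affine hull S"
  shows "\<exists>\<phi>. affine_functional \<phi> \<and> (\<forall>x\<in>S. \<phi> x = 0) \<and> \<phi> v \<noteq> 0"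
proof (cases "S = {}")
  case True
  then show ?thesis
    using affine_functional_const[of 1] by fastforce
next
  case False
  then obtain s where s: "s \<in> S" by blast
  let ?D = "(\<lambda>x. x - s) ` S"
  have eq: "affine hull S = (\<lambda>x. s + x) ` span ?D"
    using affine_hull_span_gen[OF hull_inc[OF s]] by (simp add: add.commute)
  have "v - s \<notin> span ?D"
  proof
    assume "v - s \<in> span ?D"
    then have "s + (v - s) \<in> affine hull S" unfolding eq by (rule imageI)
    then show False using assms by simp
  qed
  obtain y z where yz: "y \<in> span ?D" "\<And>w. w \<in> span ?D \<Longrightarrow> orthogonal z w" "v - s = y + z"
    using orthogonal_subspace_decomp_exists[of ?D "v - s"] by metis
  have "z \<noteq> 0"
    using yz \<open>v - s \<notin> span ?D\<close> by auto
  have "z \<bullet> (x - s) = 0" if "x \<in> S" for x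
    using yz(2)[of "x - s"] that by (simp add: orthogonal_def span_base)
  moreover have "z \<bullet> (v - s) \<noteq> 0"
    using yz \<open>z \<noteq> 0\<close> by (simp add: inner_add_right orthogonal_def)
  ultimately show ?thesis
    using affine_functional_inner[of z s] by blast
qed

section \<open>Exposed vertex sets of a simplicial polytope\<close>

lemma finite_minimizer:
  fixes f :: "'b \<Rightarrow> real"
  assumes "finite A" "A \<noteq> {}"
  shows "\<exists>a\<in>A. \<forall>v\<in>A. f a \<le> f v"
proof -
  have "Min (f ` A) \<in> f ` A"
    using assms by (intro Min_in) auto
  then obtain a where a: "a \<in> A" "f a = Min (f ` A)"
    by force
  then show ?thesis
    using assms(1) by (intro bexI[of _ a]) simp_all
qed

text \<open>For the vertex set \<open>V\<close> of a polytope these are the vertex sets of its proper faces, the empty face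
  included.\<close>

definition exposed_subset :: "'a::euclidean_space set \<Rightarrow> 'a set \<Rightarrow> bool" where
  "exposed_subset V \<tau> \<longleftrightarrow> (\<exists>\<phi>. affine_functional \<phi> \<and> (\<forall>v\<in>V. \<phi> v \<ge> 0) \<and>
      (\<exists>v\<in>V. \<phi> v \<noteq> 0) \<and> \<tau> = {v \<in> V. \<phi> v = 0})"

text \<open>The vertex set of a simplicial \<open>d\<close>-polytope, seen as an abstract simplicial complex with a
  geometric realisation: the second pair of axioms says that proper faces are simplices and that
  subsets of their vertex sets span faces again.\<close>

locale simplicial_points =
  fixes V :: "'a::euclidean_space set" and d :: nat
  assumes finite_V: "finite V"
    and aff_dim_V: "aff_dim V = int d"
    and face_independent: "exposed_subset V \<tau> \<Longrightarrow> \<not> affine_dependent \<tau>"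
    and face_subset: "exposed_subset V \<tau> \<Longrightarrow> \<tau>' \<subseteq> \<tau> \<Longrightarrow> exposed_subset V \<tau>'"
begin

abbreviation face :: "'a set \<Rightarrow> bool" where
  "face \<equiv> exposed_subset V"

lemma face_in_V: "face \<tau> \<Longrightarrow> \<tau> \<subseteq> V"
  unfolding exposed_subset_def by blast

lemma finite_face: "face \<tau> \<Longrightarrow> finite \<tau>"
  using face_in_V finite_V finite_subset by blast

lemma face_insertD: "face (insert a \<tau>) \<Longrightarrow> face \<tau>" "face (insert a \<tau>) \<Longrightarrow> a \<in> V"
  using face_subset[of "insert a \<tau>" \<tau>] face_in_V by auto

lemma support:
  assumes "face \<tau>"
  obtains k where "affine_functional k" "\<And>t. t \<in> \<tau> \<Longrightarrow> k t = 0"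
    "\<And>v. v \<in> V \<Longrightarrow> v \<notin> \<tau> \<Longrightarrow> k v > 0"
proof -
  obtain k where k: "affine_functional k" "\<forall>v\<in>V. k v \<ge> 0" "\<tau> = {v \<in> V. k v = 0}"
    using assms unfolding exposed_subset_def by blast
  show ?thesis
    by (rule that[OF k(1)]) (use k in force)+
qed

lemma aff_dim_face: "face \<tau> \<Longrightarrow> aff_dim \<tau> = int (card \<tau>) - 1"
  using aff_dim_affine_independent[OF face_independent, of \<tau>] by simp

lemma card_face_le:
  assumes "face \<tau>"
  shows "card \<tau> \<le> d"
proof -
  obtain k v where k: "affine_functional k" "\<tau> = {v \<in> V. k v = 0}" "v \<in> V" "k v \<noteq> 0"
    using assms unfolding exposed_subset_def by blast
  have "v \<notin> affine hull \<tau>"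
    using affine_functional_vanishes_hull[OF k(1), of \<tau> v] k by auto
  then have "aff_dim (insert v \<tau>) = aff_dim \<tau> + 1"
    by (simp add: aff_dim_insert)
  moreover have "aff_dim (insert v \<tau>) \<le> aff_dim V"
    using k by (intro aff_dim_subset) auto
  ultimately show ?thesis
    using aff_dim_face[OF assms] aff_dim_V by simp
qed

text \<open>A facet is a \<open>(d - 1)\<close>-simplex, so one more point outside its hyperplane spans everything; the
  functional \<open>g\<close> certifies that the point lies outside.\<close>

lemma affine_hull_insert_facet:
  assumes F: "face F" "card F = d" and z: "z \<in> affine hull V"
    and g: "affine_functional g" "\<And>x. x \<in> F \<Longrightarrow> g x = 0" "g z \<noteq> 0"
  shows "affine hull (insert z F) = affine hull V"
proof -
  have "z \<notin> affine hull F"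
    using affine_functional_vanishes_hull[OF g(1,2), of F z] g(3) by auto
  then have "aff_dim (insert z F) = aff_dim V"
    using aff_dim_face[OF F(1)] F(2) aff_dim_V by (simp add: aff_dim_insert)
  moreover have "affine hull (insert z F) \<subseteq> affine hull V"
  proof (rule hull_minimal)
    show "insert z F \<subseteq> affine hull V"
      using face_in_V[OF F(1)] z hull_subset[of V affine] by blast
  qed (rule affine_affine_hull)
  ultimately show ?thesis
    by (intro affine_dim_equal) (simp_all add: affine_affine_hull)
qed

text \<open>The uniqueness principle behind all linear relations below: a facet together with one point off
  its hyperplane determines an affine functional on the affine hull of \<open>V\<close>.\<close>

lemma zero_on_facet_and_point:
  assumes "face F" "card F = d" "z \<in> affine hull V"
    and "affine_functional g" "\<And>x. x \<in> F \<Longrightarrow> g x = 0" "g z \<noteq> 0"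
    and "affine_functional \<phi>" "\<And>x. x \<in> F \<Longrightarrow> \<phi> x = 0" "\<phi> z = 0" "y \<in> affine hull V"
  shows "\<phi> y = 0"
proof (rule affine_functional_vanishes_hull[OF assms(7)])
  show "y \<in> affine hull (insert z F)"
    using affine_hull_insert_facet[OF assms(1-6)] assms(10) by simp
qed (use assms in auto)

lemma nonempty_complement:
  assumes "face \<tau>" shows "V - \<tau> \<noteq> {}"
  using assms unfolding exposed_subset_def by blast

text \<open>Rotating a supporting hyperplane until it meets one more vertex: replace \<open>l\<close> by \<open>l - c k\<close> with \<open>c\<close> the
  smallest ratio \<open>l v / k v\<close> over the set \<open>A\<close> where \<open>k\<close> is positive.  The assumption \<open>nz\<close> prevents the
  tilted functional from vanishing on all of \<open>V\<close>.\<close>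

lemma tilt:
  assumes \<tau>: "face \<tau>" and k: "affine_functional k" "\<And>t. t \<in> \<tau> \<Longrightarrow> k t = 0"
    and A: "A \<subseteq> V" "A \<noteq> {}" "\<And>v. v \<in> V - A \<Longrightarrow> k v = 0" "\<And>v. v \<in> A \<Longrightarrow> k v > 0"
    and l: "affine_functional l" "\<And>t. t \<in> \<tau> \<Longrightarrow> l t = 0" "\<And>v. v \<in> V - A \<Longrightarrow> l v \<ge> 0"
    and nz: "\<And>c. \<exists>v\<in>V. l v \<noteq> c * k v"
  obtains c a where "a \<in> A" "l a = c * k a" "\<And>v. v \<in> V \<Longrightarrow> l v \<ge> c * k v"
    "face (insert a \<tau>)"
proof -
  have "finite A"
    using A(1) finite_V finite_subset by blast
  then obtain a where a: "a \<in> A" "\<And>v. v \<in> A \<Longrightarrow> l a / k a \<le> l v / k v"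
    using A(2) finite_minimizer[of A "\<lambda>v. l v / k v"] by blast
  define c where "c = l a / k a"
  have eq: "l a = c * k a"
    using A(4)[OF a(1)] by (simp add: c_def)
  have ge: "l v \<ge> c * k v" if "v \<in> V" for v
  proof (cases "v \<in> A")
    case True
    then show ?thesis
      using a(2)[OF True] A(4)[OF True] by (simp add: c_def pos_le_divide_eq)
  next
    case False
    then show ?thesis using A(3) l(3) that by fastforce
  qed
  have "affine_functional (\<lambda>v. l v - c * k v)"
    by (intro affine_functional_diff affine_functional_cmult k(1) l(1))
  moreover have "\<exists>v\<in>V. l v - c * k v \<noteq> 0" "\<forall>v\<in>V. l v - c * k v \<ge> 0"
    using nz[of c] ge by auto
  ultimately have "face {v \<in> V. l v - c * k v = 0}"
    unfolding exposed_subset_def by blast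
  moreover have "insert a \<tau> \<subseteq> {v \<in> V. l v - c * k v = 0}"
    using face_in_V[OF \<tau>] a(1) A(1) eq k(2) l(2) by auto
  ultimately have "face (insert a \<tau>)"
    by (rule face_subset)
  then show ?thesis
    using that a(1) eq ge by blast
qed

text \<open>Tilt the hyperplane that supports \<open>\<tau>\<close> by a functional that vanishes on \<open>\<tau>\<close> and on a further vertex
  \<open>y\<close>, but not on all of \<open>V\<close>; such a functional exists because \<open>\<tau>\<close> and \<open>y\<close> span less than dimension \<open>d\<close>.\<close>

lemma face_extends:
  assumes \<tau>: "face \<tau>" and lt: "card \<tau> < d"
  obtains a where "a \<notin> \<tau>" "face (insert a \<tau>)"
proof -
  obtain k where k: "affine_functional k" "\<And>t. t \<in> \<tau> \<Longrightarrow> k t = 0" 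
    "\<And>v. v \<in> V \<Longrightarrow> v \<notin> \<tau> \<Longrightarrow> k v > 0"
    using support[OF \<tau>] by blast
  obtain y where y: "y \<in> V" "y \<notin> \<tau>"
    using nonempty_complement[OF \<tau>] by blast
  have "aff_dim (insert y \<tau>) < aff_dim V"
    using aff_dim_face[OF \<tau>] lt aff_dim_V by (simp add: aff_dim_insert)
  then have "\<not> V \<subseteq> affine hull (insert y \<tau>)"
    using aff_dim_subset[of V "affine hull (insert y \<tau>)"] by (auto simp: aff_dim_affine_hull)
  then obtain v0 where v0: "v0 \<in> V" "v0 \<notin> affine hull (insert y \<tau>)"
    by blast
  obtain l where l: "affine_functional l" "\<forall>x\<in>insert y \<tau>. l x = 0" "l v0 \<noteq> 0"
    using affine_functional_separating[OF v0(2)] by blast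
  have nz: "\<exists>v\<in>V. l v \<noteq> c * k v" for c
  proof (rule ccontr)
    assume "\<not> ?thesis"
    then have eq: "\<And>v. v \<in> V \<Longrightarrow> l v = c * k v" by blast
    have "c = 0"
      using eq[OF y(1)] l(2) k(3)[OF y] by simp
    then show False
      using eq[OF v0(1)] l(3) by simp
  qed
  obtain c a where "a \<in> V - \<tau>" "face (insert a \<tau>)"
  proof (rule tilt[OF \<tau> k(1,2), of "V - \<tau>" l])
    show "V - \<tau> \<noteq> {}" by (rule nonempty_complement[OF \<tau>])
  qed (use k l nz in auto)
  then show ?thesis
    using that by blast
qed

lemma face_in_facet:
  assumes "face \<tau>"
  obtains F where "\<tau> \<subseteq> F" "face F" "card F = d"
proof -
  have "\<exists>F. \<tau> \<subseteq> F \<and> face F \<and> card F = d"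
    using assms
  proof (induction "d - card \<tau>" arbitrary: \<tau>)
    case 0
    then show ?case
      using card_face_le[of \<tau>] by (intro exI[of _ \<tau>]) simp
  next
    case (Suc n)
    then obtain a where a: "a \<notin> \<tau>" "face (insert a \<tau>)"
      using face_extends[of \<tau>] by force
    have "n = d - card (insert a \<tau>)"
      using Suc(2) a finite_face[OF Suc(3)] by simp
    from Suc(1)[OF this a(2)] show ?case by blast
  qed
  then show ?thesis using that by blast
qed

text \<open>The cone of \<open>V\<close> at the face \<open>\<rho>\<close> is generated by the vertices of its link.  If \<open>l\<close> were negative
  somewhere, tilting the hyperplane that supports \<open>\<rho>\<close> by \<open>l\<close> would stop at a vertex of the link at
  which \<open>l\<close> is negative.\<close>

lemma tangent_cone:
  assumes \<rho>: "face \<rho>" "card \<rho> < d"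
    and l: "affine_functional l" "\<And>t. t \<in> \<rho> \<Longrightarrow> l t = 0"
    and nonneg: "\<And>w. w \<notin> \<rho> \<Longrightarrow> face (insert w \<rho>) \<Longrightarrow> l w \<ge> 0"
    and v: "v \<in> V"
  shows "l v \<ge> 0"
proof (rule ccontr)
  assume neg: "\<not> l v \<ge> 0"
  obtain k where k: "affine_functional k" "\<And>t. t \<in> \<rho> \<Longrightarrow> k t = 0" 
    "\<And>v. v \<in> V \<Longrightarrow> v \<notin> \<rho> \<Longrightarrow> k v > 0"
    using support[OF \<rho>(1)] by blast
  obtain a0 where a0: "a0 \<notin> \<rho>" "face (insert a0 \<rho>)"
    using face_extends[OF \<rho>] by blast
  have vr: "v \<notin> \<rho>" using neg l(2) by force
  have nz: "\<exists>v\<in>V. l v \<noteq> c * k v" for c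
  proof (rule ccontr)
    assume "\<not> ?thesis"
    then have eq: "\<And>v. v \<in> V \<Longrightarrow> l v = c * k v" by blast
    have "c < 0"
    proof (rule ccontr)
      assume "\<not> c < 0"
      then have "c * k v \<ge> 0" using k(3)[OF v vr] by simp
      then show False using eq[OF v] neg by simp
    qed
    moreover have "a0 \<in> V" using face_insertD(2)[OF a0(2)] .
    ultimately show False
      using eq[of a0] nonneg[OF a0] mult_neg_pos[of c "k a0"] k(3)[OF _ a0(1)] by simp
  qed
  obtain c a where a: "a \<in> V - \<rho>" "l a = c * k a" "\<And>v. v \<in> V \<Longrightarrow> l v \<ge> c * k v" "face (insert a \<rho>)"
  proof (rule tilt[OF \<rho>(1) k(1,2), of "V - \<rho>" l])
    show "V - \<rho> \<noteq> {}" by (rule nonempty_complement[OF \<rho>(1)])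
  qed (use k l nz in auto)
  have "c \<ge> 0"
    using nonneg[of a] a k(3)[of a] by (simp add: zero_le_mult_iff)
  then have "c * k v \<ge> 0" using k(3)[OF v vr] by simp
  then show False
    using a(3)[OF v] neg by simp
qed

text \<open>The simplex method in the vertex figure of \<open>\<sigma>\<close>: if \<open>v\<close> were missed, take the vertex \<open>w\<close> of \<open>S\<close> that
  minimises \<open>q / h\<close>, where \<open>h\<close> supports \<open>\<sigma>\<close> and \<open>q\<close> supports \<open>\<sigma>\<close> together with \<open>v\<close>.  No neighbour of \<open>w\<close>
  improves the ratio, so by \<open>tangent_cone\<close> no vertex does; but the ratio at \<open>v\<close> is \<open>0\<close>.\<close>

lemma link_connected:
  assumes \<sigma>: "face \<sigma>" and card: "Suc (card \<sigma>) < d"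
    and S: "S \<noteq> {}" "\<And>w. w \<in> S \<Longrightarrow> w \<notin> \<sigma> \<and> face (insert w \<sigma>)"
    and closed: "\<And>w w'. w \<in> S \<Longrightarrow> w' \<notin> insert w \<sigma> \<Longrightarrow> face (insert w' (insert w \<sigma>)) \<Longrightarrow> w' \<in> S"
    and v: "v \<notin> \<sigma>" "face (insert v \<sigma>)"
  shows "v \<in> S"
proof (rule ccontr)
  assume vS: "v \<notin> S"
  obtain h where h: "affine_functional h" "\<And>t. t \<in> \<sigma> \<Longrightarrow> h t = 0" 
    "\<And>v. v \<in> V \<Longrightarrow> v \<notin> \<sigma> \<Longrightarrow> h v > 0"
    using support[OF \<sigma>] by blast
  obtain q where q: "affine_functional q" "\<And>t. t \<in> insert v \<sigma> \<Longrightarrow> q t = 0" 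
    "\<And>w. w \<in> V \<Longrightarrow> w \<notin> insert v \<sigma> \<Longrightarrow> q w > 0"
    using support[OF v(2)] by blast
  have SV: "S \<subseteq> V" using S(2) face_in_V by blast
  then have "finite S" using finite_V finite_subset by blast
  then obtain w where w: "w \<in> S" "\<And>w'. w' \<in> S \<Longrightarrow> q w / h w \<le> q w' / h w'"
    using S(1) finite_minimizer[of S "\<lambda>w. q w / h w"] by blast
  define N where "N = q w / h w"
  have hpos: "h x > 0" if "x \<in> S" for x using h(3) S(2) SV that by blast
  have "q w > 0"
    using q(3)[of w] w(1) SV S(2) vS by blast
  then have "N > 0" using hpos[OF w(1)] by (simp add: N_def)
  have "q v - N * h v \<ge> 0"
  proof (rule tangent_cone[of "insert w \<sigma>" "\<lambda>x. q x - N * h x"])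
    show "face (insert w \<sigma>)" using S(2) w(1) by blast
    show "card (insert w \<sigma>) < d"
      using card card_insert_le_m1 finite_face[OF \<sigma>] by (simp add: card_insert_if)
    show "affine_functional (\<lambda>x. q x - N * h x)" 
      by (intro affine_functional_diff affine_functional_cmult q(1) h(1))
    show "q t - N * h t = 0" if "t \<in> insert w \<sigma>" for t
    proof (cases "t = w")
      case True
      then show ?thesis using hpos[OF w(1)] by (simp add: N_def)
    next
      case False
      then show ?thesis using that q(2)[of t] h(2)[of t] by simp
    qed
    show "v \<in> V" using face_insertD(2)[OF v(2)] .
    show "0 \<le> q x - N * h x" if "x \<notin> insert w \<sigma>" "face (insert x (insert w \<sigma>))" for x
    proof -
      have "x \<in> S" using closed[OF w(1) that] .
      then show ?thesis
        using w(2)[of x] hpos[of x] by (simp add: N_def pos_le_divide_eq)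
    qed
  qed
  moreover have "N * h v > 0"
    using \<open>N > 0\<close> h(3)[OF face_insertD(2)[OF v(2)] v(1)] by simp
  ultimately show False
    using q(2)[of v] by simp
qed

text \<open>Affine functionals that vanish on a ridge form a two-dimensional space, in which the functionals
  \<open>ga\<close>, \<open>gb\<close> of the two adjacent facets are a basis.\<close>

lemma ridge_expansion:
  assumes a: "face (insert a \<tau>)" and b: "b \<in> V" "a \<notin> \<tau>" and card: "Suc (card \<tau>) = d"
    and ga: "affine_functional ga" "\<And>t. t \<in> insert a \<tau> \<Longrightarrow> ga t = 0" "ga b \<noteq> 0"
    and gb: "affine_functional gb" "\<And>t. t \<in> insert b \<tau> \<Longrightarrow> gb t = 0" "gb a \<noteq> 0"
    and \<phi>: "affine_functional \<phi>" "\<And>t. t \<in> \<tau> \<Longrightarrow> \<phi> t = 0"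
    and z: "z \<in> affine hull V"
  shows "\<phi> z = gb z / gb a * \<phi> a + ga z / ga b * \<phi> b"
proof -
  \<comment> \<open>vanishes on the first facet and at \<open>b\<close>, hence at \<open>z\<close>\<close>
  let ?\<psi> = "\<lambda>x. \<phi> x - (\<phi> a / gb a) * gb x - (\<phi> b / ga b) * ga x"
  have "?\<psi> z = 0"
  proof (rule zero_on_facet_and_point[OF a, where z = b and g = ga and \<phi> = ?\<psi>])
    show "card (insert a \<tau>) = d"
      using card finite_face[OF a] b(2) by simp
    show "b \<in> affine hull V" using b(1) by (rule hull_inc)
    show "affine_functional ?\<psi>"
      by (intro affine_functional_diff affine_functional_cmult \<phi>(1) ga(1) gb(1))
    show "?\<psi> x = 0" if "x \<in> insert a \<tau>" for x
      using that ga gb \<phi> by (cases "x = a") auto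
    show "?\<psi> b = 0" using ga gb by simp
  qed (use ga z in auto)
  then show ?thesis by (simp add: field_simps)
qed

text \<open>The second facet comes from tilting the first one about the ridge.  A third facet would have a
  functional that, by \<open>ridge_expansion\<close>, is a positive combination of the functionals of the other
  two, hence positive at its own vertex \<open>c\<close>.\<close>

lemma ridge_in_two_facets:
  assumes \<tau>: "face \<tau>" and card: "Suc (card \<tau>) = d"
  obtains a b where "a \<noteq> b" "{c. c \<notin> \<tau> \<and> face (insert c \<tau>)} = {a, b}"
proof -
  obtain a where a: "a \<notin> \<tau>" "face (insert a \<tau>)"
    using face_extends[OF \<tau>] card by auto
  obtain l where l: "affine_functional l" "\<And>t. t \<in> \<tau> \<Longrightarrow> l t = 0" 
    "\<And>v. v \<in> V \<Longrightarrow> v \<notin> \<tau> \<Longrightarrow> l v > 0"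
    using support[OF \<tau>] by blast
  obtain ga where ga: "affine_functional ga" "\<And>t. t \<in> insert a \<tau> \<Longrightarrow> ga t = 0" 
    "\<And>v. v \<in> V \<Longrightarrow> v \<notin> insert a \<tau> \<Longrightarrow> ga v > 0"
    using support[OF a(2)] by blast
  have aV: "a \<in> V" using face_insertD(2)[OF a(2)] .
  have "\<exists>v\<in>V. l v \<noteq> c * ga v" for c
    using ga(2)[of a] l(3)[OF aV a(1)] aV by (intro bexI[of _ a]) auto
  moreover have "l v \<ge> 0" if "v \<in> V - (V - insert a \<tau>)" for v
    using that l(2)[of v] l(3)[of v] by fastforce
  ultimately obtain b where b: "b \<in> V - insert a \<tau>" "face (insert b \<tau>)"
  proof (rule_tac tilt[OF \<tau> ga(1) _ _ nonempty_complement[OF a(2)] _ _ l(1)])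
    show "ga v = 0" if "v \<in> V - (V - insert a \<tau>)" for v
      using that ga(2) by blast
  qed (use ga(2,3) l(2) in auto)
  obtain gb where gb: "affine_functional gb" "\<And>t. t \<in> insert b \<tau> \<Longrightarrow> gb t = 0" 
    "\<And>v. v \<in> V \<Longrightarrow> v \<notin> insert b \<tau> \<Longrightarrow> gb v > 0"
    using support[OF b(2)] by blast
  have "c = a \<or> c = b" if c: "c \<notin> \<tau>" "face (insert c \<tau>)" for c
  proof (rule ccontr)
    assume ne: "\<not> ?thesis"
    obtain gc where gc: "affine_functional gc" "\<And>t. t \<in> insert c \<tau> \<Longrightarrow> gc t = 0" 
      "\<And>v. v \<in> V \<Longrightarrow> v \<notin> insert c \<tau> \<Longrightarrow> gc v > 0"
      using support[OF c(2)] by blast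
    have cV: "c \<in> V" using face_insertD(2)[OF c(2)] .
    have pos: "ga b > 0" "gb a > 0" "ga c > 0" "gb c > 0" "gc a > 0" "gc b > 0"
      using ga(3)[of b] ga(3)[of c] gb(3)[of a] gb(3)[of c] gc(3)[of a] gc(3)[of b] a b c ne aV cV by auto
    have "gc c = gb c / gb a * gc a + ga c / ga b * gc b"
      by (rule ridge_expansion[OF a(2) _ a(1) card ga(1,2) _ gb(1,2) _ gc(1)])
        (use b pos gc(2) cV in \<open>auto intro: hull_inc\<close>)
    moreover have "gb c / gb a * gc a + ga c / ga b * gc b > 0"
      using pos by (intro add_pos_pos mult_pos_pos divide_pos_pos)
    ultimately show False using gc(2)[of c] by simp
  qed
  then have "{c. c \<notin> \<tau> \<and> face (insert c \<tau>)} = {a, b}"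
    using a b by auto
  moreover have "a \<noteq> b" using b by auto
  ultimately show ?thesis using that by blast
qed

text \<open>Only the vertices of the link are recorded.\<close>

definition link :: "'a set \<Rightarrow> 'a set" where
  "link \<tau> = {w. w \<notin> \<tau> \<and> face (insert w \<tau>)}"

lemma finite_link: "finite (link \<tau>)"
proof (rule finite_subset[OF _ finite_V])
  show "link \<tau> \<subseteq> V" unfolding link_def using face_insertD(2) by blast
qed

lemma link_nonempty:
  assumes "face \<tau>" "card \<tau> < d"
  shows "link \<tau> \<noteq> {}"
proof -
  obtain a where "a \<notin> \<tau>" "face (insert a \<tau>)"
    using face_extends[OF assms] .
  then show ?thesis by (auto simp: link_def)
qed

lemma link_sym:
  "w \<in> link \<rho> \<Longrightarrow> a \<in> link (insert w \<rho>) \<Longrightarrow> a \<in> link \<rho> \<and> w \<in> link (insert a \<rho>)"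
  unfolding link_def using face_subset[of "insert a (insert w \<rho>)" "insert a \<rho>"]
  by (auto simp: insert_commute)

section \<open>The equilibrium of a link polygon\<close>

definition facet_functionals :: "('a set \<Rightarrow> 'a \<Rightarrow> real) \<Rightarrow> bool" where
  "facet_functionals G \<longleftrightarrow> (\<forall>F. face F \<and> card F = d \<longrightarrow> affine_functional (G F) \<and>
     (\<forall>t\<in>F. G F t = 0) \<and> (\<forall>v\<in>V - F. G F v > 0))"

lemma facet_functionals_exist: "\<exists>G. facet_functionals G"
proof -
  have "\<exists>g. affine_functional g \<and> (\<forall>t\<in>F. g t = 0) \<and> (\<forall>v\<in>V - F. g v > 0)" if "face F" for F
    using support[OF that] by (metis DiffD1 DiffD2)
  then show ?thesis
    unfolding facet_functionals_def by metis
qed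

lemma facet_functionalD:
  assumes "facet_functionals G" "face F" "card F = d"
  shows "affine_functional (G F)" "t \<in> F \<Longrightarrow> G F t = 0" "v \<in> V \<Longrightarrow> v \<notin> F \<Longrightarrow> G F v > 0"
  using assms unfolding facet_functionals_def by blast+

text \<open>A coordinate on the plane that remains after the span of \<open>\<rho>\<close> and \<open>z\<close> is divided out: combine the
  functionals of the two facets through the ridge \<open>insert a \<rho>\<close> so that the result vanishes at \<open>z\<close>.\<close>

lemma edge_coordinate:
  assumes G: "facet_functionals G" and card: "Suc (Suc (card \<rho>)) = d"
    and pos: "\<And>F. face F \<Longrightarrow> card F = d \<Longrightarrow> \<rho> \<subseteq> F \<Longrightarrow> G F z > 0"
    and a: "a \<in> link \<rho>" and w: "w \<in> link (insert a \<rho>)"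
  obtains e where "affine_functional e" "\<And>t. t \<in> insert a \<rho> \<Longrightarrow> e t = 0" "e z = 0" "e w > 0"
proof -
  have a': "a \<notin> \<rho>" "face (insert a \<rho>)" and w': "w \<notin> insert a \<rho>" "face (insert w (insert a \<rho>))"
    using a w unfolding link_def by auto
  have fin: "finite \<rho>" using finite_face[OF a'(2)] by simp
  have card1: "Suc (card (insert a \<rho>)) = d" using card a' fin by simp
  obtain b1 b2 where b12: "b1 \<noteq> b2"
    "{c. c \<notin> insert a \<rho> \<and> face (insert c (insert a \<rho>))} = {b1, b2}"
    using ridge_in_two_facets[OF a'(2) card1] by blast
  define b where "b = (if b1 = w then b2 else b1)"
  have "b \<in> {c. c \<notin> insert a \<rho> \<and> face (insert c (insert a \<rho>))}"
    unfolding b12(2) by (simp add: b_def)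
  moreover have "b \<noteq> w" using b12(1) by (auto simp: b_def)
  ultimately have b: "b \<noteq> w" "b \<notin> insert a \<rho>" "face (insert b (insert a \<rho>))"
    by simp_all
  define F1 F2 where "F1 = insert w (insert a \<rho>)" and "F2 = insert b (insert a \<rho>)"
  have F: "face F1" "face F2" "card F1 = d" "card F2 = d"
    using w' b card1 fin by (simp_all add: F1_def F2_def)
  have G1: "G F1 z > 0" using pos[OF F(1,3)] by (auto simp: F1_def)
  show ?thesis
  proof (rule that[of "\<lambda>x. G F2 x - (G F2 z / G F1 z) * G F1 x"])
    show "affine_functional (\<lambda>x. G F2 x - (G F2 z / G F1 z) * G F1 x)"
      by (intro affine_functional_diff affine_functional_cmult facet_functionalD(1)[OF G] F)
    show "G F2 t - G F2 z / G F1 z * G F1 t = 0" if "t \<in> insert a \<rho>" for t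
      using that facet_functionalD(2)[OF G F(1,3), of t] facet_functionalD(2)[OF G F(2,4), of t]
      by (simp add: F1_def F2_def)
    show "G F2 z - G F2 z / G F1 z * G F1 z = 0" using G1 by simp
    have "G F2 w > 0"
      by (rule facet_functionalD(3)[OF G F(2,4) face_insertD(2)[OF w'(2)]])
        (use b w' in \<open>auto simp: F2_def\<close>)
    moreover have "G F1 w = 0"
      by (rule facet_functionalD(2)[OF G F(1,3)]) (simp add: F1_def)
    ultimately show "G F2 w - G F2 z / G F1 z * G F1 w > 0" by simp
  qed
qed

text \<open>Dividing out \<open>\<rho>\<close> and \<open>z\<close> leaves a plane, in which the link of \<open>\<rho>\<close> becomes a polygon around the origin.
  The form \<open>D\<close> is the area form of this plane, written as the determinant of two coordinates.  It is
  nonzero on every edge of the polygon because a facet and \<open>z\<close> together span the whole space.\<close>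

lemma link_area_form:
  assumes G: "facet_functionals G" and \<rho>: "face \<rho>" and card: "Suc (Suc (card \<rho>)) = d"
    and z: "z \<in> affine hull V"
    and pos: "\<And>F. face F \<Longrightarrow> card F = d \<Longrightarrow> \<rho> \<subseteq> F \<Longrightarrow> G F z > 0"
  obtains D :: "'a \<Rightarrow> 'a \<Rightarrow> real" where "\<And>x. affine_functional (D x)" "\<And>x y. D x y = - D y x"
    "\<And>x t. t \<in> \<rho> \<Longrightarrow> D x t = 0" "\<And>x. D x z = 0"
    "\<And>w a. w \<in> link \<rho> \<Longrightarrow> a \<in> link (insert w \<rho>) \<Longrightarrow> D w a \<noteq> 0"
proof -
  obtain a0 where a0: "a0 \<in> link \<rho>"
    using link_nonempty[OF \<rho>] card by auto
  have "Suc (card (insert a0 \<rho>)) = d" "face (insert a0 \<rho>)"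
    using a0 card finite_face[OF \<rho>] by (auto simp: link_def)
  then obtain w0 where w0: "w0 \<in> link (insert a0 \<rho>)"
    using link_nonempty[of "insert a0 \<rho>"] by auto
  obtain e1 where e1: "affine_functional e1" "\<And>t. t \<in> insert a0 \<rho> \<Longrightarrow> e1 t = 0" "e1 z = 0" "e1 w0 > 0"
    using edge_coordinate[OF G card pos a0 w0] by blast
  obtain e2 where e2: "affine_functional e2" "\<And>t. t \<in> insert w0 \<rho> \<Longrightarrow> e2 t = 0" "e2 z = 0" "e2 a0 > 0"
    using edge_coordinate[OF G card pos, of w0 a0] link_sym[OF a0 w0] by blast
  define D where "D x y = e1 x * e2 y - e2 x * e1 y" for x y
  show ?thesis
  proof (rule that[of D])
    show "affine_functional (D x)" for x
      unfolding D_def by (intro affine_functional_diff affine_functional_cmult e1(1) e2(1))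
    show "D x y = - D y x" for x y by (simp add: D_def)
    show "D x t = 0" if "t \<in> \<rho>" for x t using that e1(2)[of t] e2(2)[of t] by (simp add: D_def)
    show "D x z = 0" for x using e1(3) e2(3) by (simp add: D_def)
    show "D w a \<noteq> 0" if w: "w \<in> link \<rho>" and a: "a \<in> link (insert w \<rho>)" for w a
    proof
      assume D0: "D w a = 0"
      \<comment> \<open>a combination of the coordinates that vanishes at \<open>w\<close> and \<open>a\<close> vanishes on a facet and at \<open>z\<close>\<close>
      obtain r s where rs: "r \<noteq> 0 \<or> s \<noteq> 0" "r * e1 w + s * e2 w = 0" "r * e1 a + s * e2 a = 0"
      proof (cases "e1 w = 0 \<and> e2 w = 0")
        case True
        show ?thesis
        proof (cases "e1 a = 0 \<and> e2 a = 0")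
          case True
          then show ?thesis using that[of 1 1] \<open>e1 w = 0 \<and> e2 w = 0\<close> by simp
        next
          case False
          then show ?thesis using that[of "e2 a" "- e1 a"] True by auto
        qed
      next
        case False
        then show ?thesis using that[of "e2 w" "- e1 w"] D0 by (auto simp: D_def)
      qed
      let ?e = "\<lambda>x. r * e1 x + s * e2 x"
      define F where "F = insert a (insert w \<rho>)"
      have F: "face F" "card F = d"
        using w a card finite_face[OF \<rho>] by (auto simp: link_def F_def)
      have GF: "G F z > 0"
        using pos[OF F] by (auto simp: F_def)
      have van: "?e y = 0" if "y \<in> V" for y
      proof (rule zero_on_facet_and_point[OF F z facet_functionalD(1)[OF G F], where \<phi> = ?e])
        show "affine_functional ?e"
          by (intro affine_functional_add affine_functional_cmult e1(1) e2(1))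
        show "?e x = 0" if "x \<in> F" for x
          using that rs e1(2)[of x] e2(2)[of x] by (auto simp: F_def)
        show "G F x = 0" if "x \<in> F" for x
          using facet_functionalD(2)[OF G F that] .
        show "G F z \<noteq> 0" using GF by simp
        show "?e z = 0" using e1(3) e2(3) by simp
        show "y \<in> affine hull V" using that by (rule hull_inc)
      qed
      have "w0 \<in> V" "a0 \<in> V"
        using w0 a0 face_insertD(2) unfolding link_def by blast+
      then show False
        using van[of w0] van[of a0] rs(1) e1(2)[of a0] e1(4) e2(2)[of w0] e2(4) by auto
    qed
  qed
qed

text \<open>Let \<open>a\<close>, \<open>b\<close> be the two neighbours of \<open>w\<close> in the link polygon.  Modulo the ridge \<open>insert w \<rho>\<close> the point \<open>z\<close>
  equals \<open>p a + q b\<close>, where \<open>p\<close> and \<open>q\<close> are positive since \<open>z\<close> lies beneath both facets.  Applying the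
  area form gives \<open>p \<bar>D w a\<bar> = q \<bar>D w b\<bar>\<close>, so \<open>p : q\<close> equals \<open>c w a : c w b\<close> with the weights
  \<open>c w a = 1 / \<bar>D w a\<bar>\<close>, which are symmetric in \<open>w\<close> and \<open>a\<close>.  Hence \<open>\<kappa> w * \<beta> w z\<close> is a sum of terms
  \<open>c w a * \<beta> w a\<close> over the edges of the polygon, and each edge contributes two terms that cancel.\<close>

lemma polygon_equilibrium:
  assumes \<rho>: "face \<rho>" and card: "Suc (Suc (card \<rho>)) = d" and G: "facet_functionals G"
    and z: "z \<in> affine hull V"
    and pos: "\<And>F. face F \<Longrightarrow> card F = d \<Longrightarrow> \<rho> \<subseteq> F \<Longrightarrow> G F z > 0"
  shows "\<exists>\<kappa>. (\<forall>w\<in>link \<rho>. \<kappa> w > 0) \<and>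
    (\<forall>\<beta>. (\<forall>w\<in>link \<rho>. affine_functional (\<beta> w) \<and> (\<forall>t\<in>insert w \<rho>. \<beta> w t = 0) \<and>
         (\<forall>a\<in>link (insert w \<rho>). \<beta> w a = - \<beta> a w))
       \<longrightarrow> (\<Sum>w\<in>link \<rho>. \<kappa> w * \<beta> w z) = 0)"
proof -
  obtain D :: "'a \<Rightarrow> 'a \<Rightarrow> real" where D: "\<And>x. affine_functional (D x)" "\<And>x y. D x y = - D y x"
    "\<And>x t. t \<in> \<rho> \<Longrightarrow> D x t = 0" "\<And>x. D x z = 0"
    "\<And>w a. w \<in> link \<rho> \<Longrightarrow> a \<in> link (insert w \<rho>) \<Longrightarrow> D w a \<noteq> 0"
    using link_area_form[OF G \<rho> card z pos] by blast
  define c where "c w a = 1 / \<bar>D w a\<bar>" for w a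
  have c_sym: "c w a = c a w" for w a
    using D(2)[of w a] by (simp add: c_def)
  define balanced where "balanced w k \<longleftrightarrow> k > 0 \<and>
    (\<forall>\<phi>. affine_functional \<phi> \<and> (\<forall>t\<in>insert w \<rho>. \<phi> t = 0) \<longrightarrow>
      k * \<phi> z = (\<Sum>a\<in>link (insert w \<rho>). c w a * \<phi> a))" for w and k :: real
  have "\<exists>k. balanced w k" if w: "w \<in> link \<rho>" for w
  proof -
    have w': "w \<notin> \<rho>" "face (insert w \<rho>)" using w by (auto simp: link_def)
    have fin: "finite \<rho>" by (rule finite_face[OF \<rho>])
    have card1: "Suc (card (insert w \<rho>)) = d" using card w' fin by simp
    obtain a b where ab: "a \<noteq> b" "link (insert w \<rho>) = {a, b}"
      using ridge_in_two_facets[OF w'(2) card1] unfolding link_def by blast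
    then have a: "a \<notin> insert w \<rho>" "face (insert a (insert w \<rho>))" 
      and b: "b \<notin> insert w \<rho>" "face (insert b (insert w \<rho>))"
      unfolding link_def by auto
    define Fa Fb where "Fa = insert a (insert w \<rho>)" and "Fb = insert b (insert w \<rho>)"
    have F: "face Fa" "face Fb" "card Fa = d" "card Fb = d"
      using a b card1 fin by (simp_all add: Fa_def Fb_def)
    have Gz: "G Fa z > 0" "G Fb z > 0"
      using pos[OF F(1,3)] pos[OF F(2,4)] by (auto simp: Fa_def Fb_def)
    have aV: "a \<in> V" and bV: "b \<in> V" using face_insertD(2) a(2) b(2) by blast+
    have "G Fa b > 0"
      by (rule facet_functionalD(3)[OF G F(1,3) bV]) (use b ab in \<open>auto simp: Fa_def\<close>)
    moreover have "G Fb a > 0"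
      by (rule facet_functionalD(3)[OF G F(2,4) aV]) (use a ab in \<open>auto simp: Fb_def\<close>)
    ultimately have Gab: "G Fa b > 0" "G Fb a > 0" .
    define p q where "p = G Fb z / G Fb a" and "q = G Fa z / G Fa b"
    have pq: "p > 0" "q > 0" using Gz Gab by (simp_all add: p_def q_def)
    have exp: "\<phi> z = p * \<phi> a + q * \<phi> b" 
      if "affine_functional \<phi>" "\<forall>t\<in>insert w \<rho>. \<phi> t = 0" for \<phi>
      unfolding p_def q_def
    proof (rule ridge_expansion[OF a(2) bV a(1) card1])
      show "affine_functional (G Fa)" "affine_functional (G Fb)"
        using facet_functionalD(1)[OF G] F by blast+
      show "G Fa t = 0" if "t \<in> insert a (insert w \<rho>)" for t
        using facet_functionalD(2)[OF G F(1,3)] that unfolding Fa_def .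
      show "G Fb t = 0" if "t \<in> insert b (insert w \<rho>)" for t
        using facet_functionalD(2)[OF G F(2,4)] that unfolding Fb_def .
    qed (use Gab that z in auto)
    have Dww: "D w w = 0" using D(2)[of w w] by simp
    have "p * D w a + q * D w b = 0"
      using exp[OF D(1)[of w]] D(3)[of _ w] D(4)[of w] Dww by simp
    then have "p * D w a = - (q * D w b)" by simp
    then have "\<bar>p * D w a\<bar> = \<bar>q * D w b\<bar>" by simp
    then have eq: "p * \<bar>D w a\<bar> = q * \<bar>D w b\<bar>" using pq by (simp add: abs_mult)
    have nz: "D w a \<noteq> 0" "D w b \<noteq> 0"
      using D(5)[OF w] ab(2) by auto
    define k where "k = 1 / (p * \<bar>D w a\<bar>)"
    have "k > 0" using pq nz by (simp add: k_def)
    moreover have "k * \<phi> z = (\<Sum>a\<in>link (insert w \<rho>). c w a * \<phi> a)"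
      if "affine_functional \<phi> \<and> (\<forall>t\<in>insert w \<rho>. \<phi> t = 0)" for \<phi>
    proof -
      have "k * p = c w a" using pq nz by (simp add: k_def c_def)
      moreover have "k * q = c w b" unfolding k_def eq using pq nz by (simp add: c_def)
      ultimately have "k * (p * \<phi> a + q * \<phi> b) = c w a * \<phi> a + c w b * \<phi> b"
        by (simp add: distrib_left flip: mult.assoc)
      then show ?thesis using exp that ab by simp
    qed
    ultimately show ?thesis unfolding balanced_def by blast
  qed
  then obtain \<kappa> where "\<forall>w\<in>link \<rho>. balanced w (\<kappa> w)"
    using bchoice[of "link \<rho>" balanced] by auto
  then have \<kappa>: "\<And>w. w \<in> link \<rho> \<Longrightarrow> \<kappa> w > 0"
    "\<And>w \<phi>. w \<in> link \<rho> \<Longrightarrow> affine_functional \<phi> \<Longrightarrow> (\<And>t. t \<in> insert w \<rho> \<Longrightarrow> \<phi> t = 0) \<Longrightarrow>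
      \<kappa> w * \<phi> z = (\<Sum>a\<in>link (insert w \<rho>). c w a * \<phi> a)"
    unfolding balanced_def by simp_all
  show ?thesis
  proof (intro exI[of _ \<kappa>] conjI allI impI ballI \<kappa>(1))
    fix \<beta> :: "'a \<Rightarrow> 'a \<Rightarrow> real"
    assume "\<forall>w\<in>link \<rho>. affine_functional (\<beta> w) \<and> (\<forall>t\<in>insert w \<rho>. \<beta> w t = 0) \<and>
      (\<forall>a\<in>link (insert w \<rho>). \<beta> w a = - \<beta> a w)"
    then have \<beta>: "affine_functional (\<beta> w)" "\<And>t. t \<in> insert w \<rho> \<Longrightarrow> \<beta> w t = 0"
       "\<And>a. a \<in> link (insert w \<rho>) \<Longrightarrow> \<beta> w a = - \<beta> a w" if "w \<in> link \<rho>" for w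
      using that by auto
    define T where "T w a = (if a \<in> link (insert w \<rho>) then c w a * \<beta> w a else 0)" for w a
    have anti: "T w a = - T a w" if "w \<in> link \<rho>" "a \<in> link \<rho>" for w a
    proof -
      have "a \<in> link (insert w \<rho>) \<longleftrightarrow> w \<in> link (insert a \<rho>)"
        using link_sym that by blast
      then show ?thesis
        using \<beta>(3)[OF that(1)] c_sym[of w a] by (simp add: T_def)
    qed
    have "(\<Sum>w\<in>link \<rho>. \<kappa> w * \<beta> w z) = (\<Sum>w\<in>link \<rho>. \<Sum>a\<in>link \<rho>. T w a)"
    proof (rule sum.cong[OF refl])
      fix w assume w: "w \<in> link \<rho>"
      have "\<kappa> w * \<beta> w z = (\<Sum>a\<in>link (insert w \<rho>). c w a * \<beta> w a)"
        by (rule \<kappa>(2)[OF w \<beta>(1)[OF w] \<beta>(2)[OF w]])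
      also have "\<dots> = (\<Sum>a\<in>link \<rho>. T w a)"
        unfolding T_def
        by (rule sum.mono_neutral_cong_left) (use finite_link link_sym[OF w] in auto)
      finally show "\<kappa> w * \<beta> w z = (\<Sum>a\<in>link \<rho>. T w a)" .
    qed
    also have "\<dots> = (\<Sum>w\<in>link \<rho>. \<Sum>a\<in>link \<rho>. - T a w)"
      by (intro sum.cong refl anti)
    also have "\<dots> = - (\<Sum>w\<in>link \<rho>. \<Sum>a\<in>link \<rho>. T a w)"
      by (simp add: sum_negf)
    also have "(\<Sum>w\<in>link \<rho>. \<Sum>a\<in>link \<rho>. T a w) = (\<Sum>a\<in>link \<rho>. \<Sum>w\<in>link \<rho>. T a w)"
      by (rule sum.swap)
    finally have "2 * (\<Sum>w\<in>link \<rho>. \<kappa> w * \<beta> w z) = 0"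
      using \<open>(\<Sum>w\<in>link \<rho>. \<kappa> w * \<beta> w z) = (\<Sum>w\<in>link \<rho>. \<Sum>a\<in>link \<rho>. T w a)\<close> by simp
    then show "(\<Sum>w\<in>link \<rho>. \<kappa> w * \<beta> w z) = 0" by simp
  qed
qed

section \<open>Infinitesimal rigidity\<close>

text \<open>The infinitesimal flexes of the edge graph, those of the rigid motions included.\<close>

definition flex :: "('a \<Rightarrow> 'a) \<Rightarrow> bool" where
  "flex a \<longleftrightarrow> (\<forall>u w. u \<noteq> w \<and> face {u, w} \<longrightarrow> (a u - a w) \<bullet> (u - w) = 0)"

lemma flexD:
  assumes "flex a" "u \<noteq> w" "face \<tau>" "u \<in> \<tau>" "w \<in> \<tau>"
  shows "(a u - a w) \<bullet> (u - w) = 0"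
  using assms face_subset[of \<tau> "{u, w}"] unfolding flex_def by auto

text \<open>Subtract an infinitesimal rigid motion that agrees with \<open>a\<close> at \<open>v\<close>, vanishes on \<open>\<sigma>\<close>, and whose
  displacement towards \<open>z\<close> is proportional to \<open>h\<close>.  As a form in two points \<open>x\<close>, \<open>y\<close> it is \<open>\<phi> x * a v \<bullet> (y - v) - \<phi> y * a v \<bullet> (x - v)\<close> with
  \<open>\<phi> = h / h v\<close>.  The remainder \<open>\<beta>\<close> vanishes on \<open>insert v \<sigma>\<close> and is alternating on edges, so that
  \<open>polygon_equilibrium\<close> applies.\<close>

lemma displacement_harmonic:
  assumes G: "facet_functionals G" and flex: "flex a"
    and card: "Suc (Suc (Suc (card \<sigma>))) = d"
    and v: "v \<in> link \<sigma>"
    and a0: "\<And>s. s \<in> \<sigma> \<Longrightarrow> a s = 0"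
    and z: "z \<in> affine hull V"
    and pos: "\<And>F. face F \<Longrightarrow> card F = d \<Longrightarrow> insert v \<sigma> \<subseteq> F \<Longrightarrow> G F z > 0"
    and h: "affine_functional h" "\<And>s. s \<in> \<sigma> \<Longrightarrow> h s = 0" "h z = 0" "h v > 0"
  shows "\<exists>\<kappa>. (\<forall>w\<in>link (insert v \<sigma>). \<kappa> w > 0) \<and>
    (\<Sum>w\<in>link (insert v \<sigma>). \<kappa> w * (a w \<bullet> (z - w) - h w / h v * (a v \<bullet> (z - v)))) = 0"
proof -
  define \<rho> where "\<rho> = insert v \<sigma>"
  have v': "v \<notin> \<sigma>" "face \<rho>" using v by (auto simp: link_def \<rho>_def)
  have card\<rho>: "Suc (Suc (card \<rho>)) = d"
    using card v' finite_face[OF v'(2)] by (simp add: \<rho>_def)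
  obtain \<kappa> where \<kappa>: "\<forall>w\<in>link \<rho>. \<kappa> w > 0"
    "\<forall>\<beta>. (\<forall>w\<in>link \<rho>. affine_functional (\<beta> w) \<and> (\<forall>t\<in>insert w \<rho>. \<beta> w t = 0) \<and>
         (\<forall>a\<in>link (insert w \<rho>). \<beta> w a = - \<beta> a w))
       \<longrightarrow> (\<Sum>w\<in>link \<rho>. \<kappa> w * \<beta> w z) = 0"
    using polygon_equilibrium[OF v'(2) card\<rho> G z pos[folded \<rho>_def]] by auto
  define \<phi> where "\<phi> x = h x / h v" for x
  have \<phi>: "\<phi> v = 1" "\<phi> z = 0" "\<And>s. s \<in> \<sigma> \<Longrightarrow> \<phi> s = 0"
    using h by (simp_all add: \<phi>_def)
  have aff\<phi>: "affine_functional \<phi>"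
    using affine_functional_cmult[OF h(1), of "1 / h v"] by (simp add: \<phi>_def[abs_def])
  define \<beta> where "\<beta> w y = a w \<bullet> (y - w) - \<phi> w * (a v \<bullet> (y - v)) + (a v \<bullet> (w - v)) * \<phi> y" for w y
  have edge: "a u \<bullet> (w - u) = - (a w \<bullet> (u - w))" if "u \<noteq> w" "face \<tau>" "u \<in> \<tau>" "w \<in> \<tau>" for u w \<tau>
    using flexD[OF flex that] by (simp add: inner_diff_left inner_diff_right)
  have "(\<Sum>w\<in>link \<rho>. \<kappa> w * \<beta> w z) = 0"
  proof (rule \<kappa>(2)[rule_format], intro conjI ballI)
    show "affine_functional (\<beta> w)" for w
      unfolding \<beta>_def by (intro affine_functional_add affine_functional_diff
          affine_functional_cmult affine_functional_inner aff\<phi>)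
    show "\<beta> w t = 0" if w: "w \<in> link \<rho>" and t: "t \<in> insert w \<rho>" for w t
    proof -
      have w': "w \<notin> \<rho>" "face (insert w \<rho>)" using w by (auto simp: link_def)
      consider "t = w" | "t = v" | "t \<in> \<sigma>" using t by (auto simp: \<rho>_def)
      then show ?thesis
      proof cases
        case 1
        then show ?thesis by (simp add: \<beta>_def)
      next
        case 2
        have "a w \<bullet> (v - w) = - (a v \<bullet> (w - v))"
          by (rule edge[OF _ w'(2)]) (use w' in \<open>auto simp: \<rho>_def\<close>)
        then show ?thesis using 2 \<phi>(1) by (simp add: \<beta>_def)
      next
        case 3
        have "a w \<bullet> (t - w) = - (a t \<bullet> (w - t))"
          by (rule edge[OF _ w'(2)]) (use w' 3 in \<open>auto simp: \<rho>_def\<close>)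
        moreover have "a v \<bullet> (t - v) = - (a t \<bullet> (v - t))"
          by (rule edge[OF _ w'(2)]) (use v' 3 in \<open>auto simp: \<rho>_def\<close>)
        ultimately show ?thesis using a0[OF 3] \<phi>(3)[OF 3] by (simp add: \<beta>_def)
      qed
    qed
    show "\<beta> w x = - \<beta> x w" if w: "w \<in> link \<rho>" and x: "x \<in> link (insert w \<rho>)" for w x
    proof -
      have "a w \<bullet> (x - w) = - (a x \<bullet> (w - x))"
        by (rule edge[of _ _ "insert x (insert w \<rho>)"]) (use x in \<open>auto simp: link_def\<close>)
      then show ?thesis by (simp add: \<beta>_def)
    qed
  qed
  then have "(\<Sum>w\<in>link \<rho>. \<kappa> w * (a w \<bullet> (z - w) - h w / h v * (a v \<bullet> (z - v)))) = 0"
    using h(3) by (simp add: \<beta>_def \<phi>_def)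
  then show ?thesis using \<kappa>(1) by (intro exI[of _ \<kappa>]) (simp add: \<rho>_def)
qed

text \<open>The maximum principle.  If \<open>f w = a w \<bullet> (z - w)\<close> were positive somewhere, let \<open>M > 0\<close> be the maximum of
  \<open>f / h\<close> over the link of \<open>\<sigma>\<close>.  It is not attained on \<open>F0\<close>, where \<open>f = 0\<close>.  At any vertex where it is
  attained, \<open>displacement_harmonic\<close> forces it to be attained at all neighbours, hence on the whole
  connected link, which contains vertices of \<open>F0\<close>.\<close>

lemma displacement_nonpos:
  assumes G: "facet_functionals G" and flex: "flex a"
    and card: "Suc (Suc (Suc (card \<sigma>))) = d"
    and F0: "face F0" "card F0 = d" "\<sigma> \<subseteq> F0" and a0: "\<And>s. s \<in> F0 \<Longrightarrow> a s = 0"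
    and z: "z \<in> affine hull V"
    and pos: "\<And>F. face F \<Longrightarrow> card F = d \<Longrightarrow> F \<noteq> F0 \<Longrightarrow> G F z > 0"
    and h: "affine_functional h" "\<And>s. s \<in> \<sigma> \<Longrightarrow> h s = 0" "h z = 0" "\<And>v. v \<in> V - \<sigma> \<Longrightarrow> h v > 0"
    and w: "w \<in> link \<sigma>"
  shows "a w \<bullet> (z - w) \<le> 0"
proof (rule ccontr)
  assume neg: "\<not> ?thesis"
  define f where "f w = a w \<bullet> (z - w)" for w
  have hpos: "h w > 0" if "w \<in> link \<sigma>" for w
    using h(4)[of w] that face_insertD(2) by (auto simp: link_def)
  obtain v where v: "v \<in> link \<sigma>" "\<And>w. w \<in> link \<sigma> \<Longrightarrow> - (f v / h v) \<le> - (f w / h w)"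
    using finite_minimizer[OF finite_link, of \<sigma> "\<lambda>w. - (f w / h w)"] w by auto
  define M where "M = f v / h v"
  have le: "f x \<le> M * h x" if "x \<in> link \<sigma>" for x
    using v(2)[OF that] hpos[OF that] by (simp add: M_def pos_divide_le_eq)
  have "f w > 0" using neg by (simp add: f_def)
  then have "M * h w > 0" using le[OF w] by simp
  then have M: "M > 0" using hpos[OF w] by (simp add: zero_less_mult_iff)
  define S where "S = {x \<in> link \<sigma>. f x = M * h x}"
  have "v \<in> S" using v(1) hpos[OF v(1)] by (simp add: S_def M_def)
  have notF0: "x \<notin> F0" if "x \<in> S" for x
  proof
    assume "x \<in> F0"
    then have "f x = 0" using a0 by (simp add: f_def)
    then show False using that M hpos[of x] by (simp add: S_def)
  qed
  have \<sigma>: "face \<sigma>" by (rule face_subset[OF F0(1,3)])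
  have "\<not> F0 \<subseteq> \<sigma>"
    using card_mono[OF finite_face[OF \<sigma>], of F0] F0(2) card by auto
  then obtain y where y: "y \<in> F0" "y \<notin> \<sigma>" by blast
  have "y \<in> S"
  proof (rule link_connected[OF \<sigma>, of S y])
    show "Suc (card \<sigma>) < d" using card by simp
    show "S \<noteq> {}" using \<open>v \<in> S\<close> by blast
    show "x \<notin> \<sigma> \<and> face (insert x \<sigma>)" if "x \<in> S" for x
      using that by (simp add: S_def link_def)
    show "y \<notin> \<sigma>" by (rule y(2))
    show "face (insert y \<sigma>)" by (rule face_subset[OF F0(1)]) (use y F0(3) in auto)
    show "w' \<in> S" if x: "x \<in> S" and w': "w' \<notin> insert x \<sigma>" "face (insert w' (insert x \<sigma>))" for x w'
    proof -
      have xl: "x \<in> link \<sigma>" using x by (simp add: S_def)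
      have fx: "f x = M * h x" using x by (simp add: S_def)
      have "\<exists>\<kappa>. (\<forall>w\<in>link (insert x \<sigma>). \<kappa> w > 0) \<and>
        (\<Sum>w\<in>link (insert x \<sigma>). \<kappa> w * (a w \<bullet> (z - w) - h w / h x * (a x \<bullet> (z - x)))) = 0"
      proof (rule displacement_harmonic[OF G flex card xl _ z _ h(1) h(2) h(3) hpos[OF xl]])
        show "a s = 0" if "s \<in> \<sigma>" for s using a0 F0(3) that by blast
        show "G F z > 0" if "face F" "card F = d" "insert x \<sigma> \<subseteq> F" for F
          using pos[OF that(1,2)] notF0[OF x] that(3) by blast
      qed
      then obtain \<kappa> where \<kappa>: "\<And>w. w \<in> link (insert x \<sigma>) \<Longrightarrow> \<kappa> w > 0"
        "(\<Sum>w\<in>link (insert x \<sigma>). \<kappa> w * (a w \<bullet> (z - w) - h w / h x * (a x \<bullet> (z - x)))) = 0"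
        by auto
      have sub: "u \<in> link \<sigma>" if "u \<in> link (insert x \<sigma>)" for u
        using link_sym[OF xl that] by simp
      have eq: "\<kappa> u * (M * h u - f u) = - (\<kappa> u * (a u \<bullet> (z - u) - h u / h x * (a x \<bullet> (z - x))))" for u
        using fx hpos[OF xl] by (simp add: f_def field_simps)
      have "(\<Sum>u\<in>link (insert x \<sigma>). \<kappa> u * (M * h u - f u)) = 0"
        unfolding eq sum_negf \<kappa>(2) by simp
      moreover have "\<kappa> u * (M * h u - f u) \<ge> 0" if "u \<in> link (insert x \<sigma>)" for u
        using \<kappa>(1)[OF that] le[OF sub[OF that]] by simp
      ultimately have "\<forall>u\<in>link (insert x \<sigma>). \<kappa> u * (M * h u - f u) = 0"
        by (simp only: sum_nonneg_eq_0_iff[OF finite_link])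
      moreover have w'l: "w' \<in> link (insert x \<sigma>)" using w' by (simp add: link_def)
      ultimately have "f w' = M * h w'" using \<kappa>(1)[OF w'l] by force
      then show ?thesis using sub[OF w'l] by (simp add: S_def)
    qed
  qed
  then show False using notF0 y(1) by blast
qed

lemma flex_uminus: "flex a \<Longrightarrow> flex (\<lambda>x. - a x)"
  unfolding flex_def by (metis (no_types, lifting) inner_minus_left minus_diff_minus neg_equal_0_iff_equal)

text \<open>Start at the centroid of \<open>F0\<close>, where all other facet functionals are positive, and move away from a
  vertex \<open>o'\<close> opposite to \<open>F0\<close> by a small amount.  The functional \<open>k\<close> will be one that supports a smaller face.\<close>

lemma point_beyond_facet:
  assumes G: "facet_functionals G" and F0: "face F0" "card F0 = d" and d: "d > 0"
    and k: "affine_functional k" "\<And>v. v \<in> V \<Longrightarrow> k v \<ge> 0" "\<exists>s\<in>F0. k s \<noteq> 0"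
  obtains z \<epsilon> where "z \<in> affine hull V" "\<epsilon> > 0"
    "\<And>y. dist z y < \<epsilon> \<Longrightarrow> G F0 y < 0 \<and> k y > 0 \<and> (\<forall>F. face F \<and> card F = d \<and> F \<noteq> F0 \<longrightarrow> G F y > 0)"
proof -
  define y where "y = (\<Sum>s\<in>F0. (1 / real d) *\<^sub>R s)"
  have one: "(\<Sum>s\<in>F0. 1 / real d) = 1" using F0(2) d by simp
  have F0V: "F0 \<subseteq> V" by (rule face_in_V[OF F0(1)])
  have fin: "finite F0" by (rule finite_face[OF F0(1)])
  have val: "\<phi> y = (\<Sum>s\<in>F0. \<phi> s) / real d" if "affine_functional \<phi>" for \<phi>
    using affine_functional_sum[OF that one] by (simp add: y_def sum_divide_distrib)
  have posy: "\<phi> y > 0" if "affine_functional \<phi>" "\<And>s. s \<in> F0 \<Longrightarrow> \<phi> s \<ge> 0" "\<exists>s\<in>F0. \<phi> s \<noteq> 0" for \<phi>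
  proof -
    from that(3) obtain s where s: "s \<in> F0" "\<phi> s \<noteq> 0" by blast
    have "\<phi> s > 0" using that(2)[OF s(1)] s(2) by simp
    then have "(\<Sum>s\<in>F0. \<phi> s) > 0"
      by (rule sum_pos2[OF fin s(1)]) (rule that(2))
    then show ?thesis using val[OF that(1)] d by simp
  qed
  define FF where "FF = {F. face F \<and> card F = d \<and> F \<noteq> F0}"
  have "FF \<subseteq> Pow V" using face_in_V by (auto simp: FF_def)
  then have finFF: "finite FF" using finite_V by (meson finite_Pow_iff finite_subset)
  define Q where "Q = {x. k x > 0} \<inter> (\<Inter>F\<in>FF. {x. G F x > 0})"
  have open_pos: "open {x. \<phi> x > 0}" if "affine_functional \<phi>" for \<phi> :: "'a \<Rightarrow> real"
    using open_Collect_less[OF continuous_on_const affine_functional_continuous[OF that]] .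
  have "open Q"
    unfolding Q_def using finFF facet_functionalD(1)[OF G] k(1)
    by (intro open_Int open_INT ballI open_pos) (auto simp: FF_def)
  have "y \<in> Q"
  proof -
    have "k y > 0" using k F0V by (intro posy) auto
    moreover have "G F y > 0" if "F \<in> FF" for F
    proof (rule posy)
      have F: "face F" "card F = d" "F \<noteq> F0" using that by (auto simp: FF_def)
      show "affine_functional (G F)" by (rule facet_functionalD(1)[OF G F(1,2)])
      show "G F s \<ge> 0" if "s \<in> F0" for s
        using facet_functionalD(2,3)[OF G F(1,2), of s] that F0V by (cases "s \<in> F") (auto intro: less_imp_le)
      have "\<not> F0 \<subseteq> F"
        using card_subset_eq[OF finite_face[OF F(1)], of F0] F F0(2) by auto
      then obtain s where "s \<in> F0" "s \<notin> F" by blast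
      then show "\<exists>s\<in>F0. G F s \<noteq> 0"
        using facet_functionalD(3)[OF G F(1,2), of s] F0V by (intro bexI[of _ s]) auto
    qed
    ultimately show ?thesis by (simp add: Q_def)
  qed
  obtain o' where o: "o' \<in> V" "o' \<notin> F0" using nonempty_complement[OF F0(1)] by blast
  \<comment> \<open>along this ray the functional of \<open>F0\<close> decreases from \<open>0\<close>, as it is positive at \<open>o'\<close>\<close>
  define c where "c t = y + t *\<^sub>R (y - o')" for t :: real
  have "isCont c 0" unfolding c_def by (intro continuous_intros)
  moreover have "c 0 = y" by (simp add: c_def)
  ultimately have "eventually (\<lambda>t. c t \<in> Q) (at 0)"
    using topological_tendstoD[OF _ \<open>open Q\<close>, of c y "at 0"] \<open>y \<in> Q\<close> by (simp add: isCont_def)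
  then obtain e where e: "e > 0" "\<And>t. t \<noteq> 0 \<Longrightarrow> dist t 0 < e \<Longrightarrow> c t \<in> Q"
    unfolding eventually_at by auto
  define z where "z = c (e / 2)"
  have zQ: "z \<in> Q" unfolding z_def using e by simp
  have yV: "y \<in> affine hull V"
  proof -
    have "y \<in> affine hull F0"
      unfolding y_def affine_hull_finite[OF fin] using one
      by (intro CollectI exI[of _ "\<lambda>_. 1 / real d"] conjI refl)
    then show ?thesis using hull_mono[OF F0V, of affine] by blast
  qed
  have zV: "z \<in> affine hull V"
  proof -
    have "(1 + e/2) *\<^sub>R y + (- (e/2)) *\<^sub>R o' \<in> affine hull V"
      by (rule mem_affine[OF affine_affine_hull yV hull_inc[OF o(1)]]) simp
    then show ?thesis by (simp add: z_def c_def algebra_simps)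
  qed
  have "G F0 z < 0"
  proof -
    obtain u r where G0: "G F0 = (\<lambda>x. u \<bullet> x + r)"
      using facet_functionalD(1)[OF G F0] unfolding affine_functional_def by blast
    have "G F0 y = 0"
      using val[OF facet_functionalD(1)[OF G F0]] facet_functionalD(2)[OF G F0] by simp
    moreover have "G F0 o' > 0" using facet_functionalD(3)[OF G F0 o] .
    moreover have "G F0 z = G F0 y + e / 2 * (G F0 y - G F0 o')"
      by (simp add: G0 z_def c_def inner_add_right inner_diff_right algebra_simps)
    ultimately show ?thesis using e(1) by (simp add: mult_pos_neg)
  qed
  moreover have "open {x. G F0 x < 0}"
    using open_Collect_less[OF affine_functional_continuous[OF facet_functionalD(1)[OF G F0]] continuous_on_const] .
  ultimately have "open (Q \<inter> {x. G F0 x < 0})" "z \<in> Q \<inter> {x. G F0 x < 0}"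
    using \<open>open Q\<close> zQ by auto
  then obtain \<epsilon> where "\<epsilon> > 0" "ball z \<epsilon> \<subseteq> Q \<inter> {x. G F0 x < 0}"
    by (meson openE)
  then show ?thesis
    using that[OF zV, of \<epsilon>] by (force simp: Q_def FF_def subset_iff)
qed

text \<open>The maximum principle for \<open>a\<close> and \<open>- a\<close> gives \<open>a w \<bullet> (y - w) = 0\<close> for all points \<open>y\<close> of the affine hull
  near \<open>z\<close>.  As \<open>a w\<close> is itself a direction of the affine hull, two such points that differ by a
  multiple of \<open>a w\<close> show that \<open>a w = 0\<close>.\<close>

lemma star_rigid_base:
  assumes flex: "flex a"
    and tangent: "\<And>v z t. v \<in> V \<Longrightarrow> z \<in> affine hull V \<Longrightarrow> z + t *\<^sub>R a v \<in> affine hull V"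
    and card: "Suc (Suc (Suc (card \<sigma>))) = d"
    and F0: "face F0" "card F0 = d" "\<sigma> \<subseteq> F0" and a0: "\<And>s. s \<in> F0 \<Longrightarrow> a s = 0"
    and w: "w \<in> link \<sigma>"
  shows "a w = 0"
proof (rule ccontr)
  assume nz: "a w \<noteq> 0"
  obtain G where G: "facet_functionals G" using facet_functionals_exist by blast
  have \<sigma>: "face \<sigma>" by (rule face_subset[OF F0(1,3)])
  obtain k where k: "affine_functional k" "\<And>t. t \<in> \<sigma> \<Longrightarrow> k t = 0" 
    "\<And>v. v \<in> V \<Longrightarrow> v \<notin> \<sigma> \<Longrightarrow> k v > 0"
    using support[OF \<sigma>] by blast
  have "\<not> F0 \<subseteq> \<sigma>"
    using card_mono[OF finite_face[OF \<sigma>], of F0] F0(2) card by auto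
  then obtain y where "y \<in> F0" "y \<notin> \<sigma>" by blast
  then have kF0: "\<exists>s\<in>F0. k s \<noteq> 0"
    using k(3)[of y] face_in_V[OF F0(1)] by (intro bexI[of _ y]) auto
  have k0: "k v \<ge> 0" if "v \<in> V" for v
    using k(2)[of v] k(3)[OF that] by (cases "v \<in> \<sigma>") (auto intro: less_imp_le)
  have "d > 0" using card by simp
  then obtain z \<epsilon> where z: "z \<in> affine hull V" and \<epsilon>: "\<epsilon> > 0"
    and near: "\<And>y. dist z y < \<epsilon> \<Longrightarrow> G F0 y < 0 \<and> k y > 0 \<and> (\<forall>F. face F \<and> card F = d \<and> F \<noteq> F0 \<longrightarrow> G F y > 0)"
    using point_beyond_facet[OF G F0(1,2) _ k(1) k0 kF0] by blast
  have zero: "a w \<bullet> (y - w) = 0" if y: "dist z y < \<epsilon>" "y \<in> affine hull V" for y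
  proof -
    note ny = near[OF y(1)]
    \<comment> \<open>the hyperplane through \<open>y\<close> that supports \<open>\<sigma>\<close>: the coefficient is positive as \<open>y\<close> is beyond \<open>F0\<close>\<close>
    define h where "h x = k x + (- k y / G F0 y) * G F0 x" for x
    have h: "affine_functional h"
      unfolding h_def by (intro affine_functional_add affine_functional_cmult k(1) facet_functionalD(1)[OF G F0(1,2)])
    have h\<sigma>: "h s = 0" if "s \<in> \<sigma>" for s
      using k(2)[OF that] facet_functionalD(2)[OF G F0(1,2), of s] F0(3) that by (auto simp: h_def)
    have hy: "h y = 0" using ny by (simp add: h_def)
    have hpos: "h v > 0" if "v \<in> V - \<sigma>" for v
    proof -
      have "G F0 v \<ge> 0"
        using facet_functionalD(2,3)[OF G F0(1,2), of v] that by (cases "v \<in> F0") (auto intro: less_imp_le)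
      moreover have "- k y / G F0 y > 0" using ny by (simp add: divide_pos_neg divide_neg_neg)
      ultimately show ?thesis
        using k(3)[of v] that unfolding h_def by (intro add_pos_nonneg mult_nonneg_nonneg) auto
    qed
    have pos: "G F y > 0" if "face F" "card F = d" "F \<noteq> F0" for F using ny that by blast
    have "a w \<bullet> (y - w) \<le> 0"
      by (rule displacement_nonpos[OF G flex card F0 a0 y(2) pos h h\<sigma> hy hpos w])
    moreover have "- a w \<bullet> (y - w) \<le> 0"
      by (rule displacement_nonpos[OF G flex_uminus[OF flex] card F0 _ y(2) pos h h\<sigma> hy hpos w]) (use a0 in auto)
    ultimately show ?thesis by simp
  qed
  define t where "t = \<epsilon> / (2 * norm (a w))"
  have "t > 0" using \<epsilon> nz by (simp add: t_def)
  have "dist z (z + t *\<^sub>R a w) < \<epsilon>"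
    using \<epsilon> nz by (simp add: t_def dist_norm)
  moreover have "w \<in> V" using w face_insertD(2) by (auto simp: link_def)
  ultimately have "a w \<bullet> (z + t *\<^sub>R a w - w) = 0"
    using zero tangent[OF _ z] by blast
  moreover have "a w \<bullet> (z - w) = 0" using zero[of z] \<epsilon> z by simp
  ultimately have "t * (a w \<bullet> a w) = 0"
    by (simp add: inner_diff_right inner_add_right)
  then show False using \<open>t > 0\<close> nz by simp
qed

text \<open>Induction on \<open>n = d - 3 - card \<sigma>\<close>.  In the step, a facet on which \<open>a\<close> vanishes makes \<open>a\<close> vanish on the
  star of \<open>insert u \<sigma>\<close> for each of its vertices \<open>u\<close> outside \<open>\<sigma>\<close>.  This star has a facet in common with the
  star of \<open>insert u' \<sigma>\<close> for every neighbour \<open>u'\<close> of \<open>u\<close> in the link of \<open>\<sigma>\<close>, and the link is connected.\<close>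

lemma star_rigid:
  assumes flex: "flex a"
    and tangent: "\<And>v z t. v \<in> V \<Longrightarrow> z \<in> affine hull V \<Longrightarrow> z + t *\<^sub>R a v \<in> affine hull V"
    and card: "card \<sigma> + 3 + n = d"
    and F0: "face F0" "card F0 = d" "\<sigma> \<subseteq> F0" and a0: "\<And>s. s \<in> F0 \<Longrightarrow> a s = 0"
    and F: "face F" "card F = d" "\<sigma> \<subseteq> F" and w: "w \<in> F"
  shows "a w = 0"
  using card F0 a0 F w
proof (induction n arbitrary: \<sigma> F0 F w)
  case 0
  show ?case
  proof (cases "w \<in> \<sigma>")
    case True
    then show ?thesis using 0 by blast
  next
    case False
    then have "w \<in> link \<sigma>"
      using 0 face_subset[of F "insert w \<sigma>"] by (simp add: link_def)
    then show ?thesis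
      using star_rigid_base[OF flex tangent _ 0(2,3,4) 0(5)] 0(1) by simp
  qed
next
  case (Suc n)
  have \<sigma>: "face \<sigma>" using face_subset Suc.prems(2,4) by blast
  have step: "card (insert u \<sigma>) + 3 + n = d" if "u \<notin> \<sigma>" for u
    using Suc.prems(1) finite_face[OF \<sigma>] that by simp
  \<comment> \<open>the vertices of the link over whose whole star \<open>a\<close> vanishes\<close>
  define S where "S = {u \<in> link \<sigma>. \<forall>F x. face F \<and> card F = d \<and> insert u \<sigma> \<subseteq> F \<and> x \<in> F \<longrightarrow> a x = 0}"
  have spread: "u \<in> S" if u: "u \<notin> \<sigma>" "u \<in> F1" and F1: "face F1" "card F1 = d" "\<sigma> \<subseteq> F1"
    "\<And>s. s \<in> F1 \<Longrightarrow> a s = 0" for u F1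
  proof -
    have "a x = 0" if "face F'" "card F' = d" "insert u \<sigma> \<subseteq> F'" "x \<in> F'" for F' x
      by (rule Suc.IH[OF step[OF u(1)] F1(1,2) _ F1(4) that]) (use u F1 in auto)
    moreover have "u \<in> link \<sigma>"
      using u face_subset[OF F1(1), of "insert u \<sigma>"] F1(3) by (simp add: link_def)
    ultimately show ?thesis unfolding S_def by blast
  qed
  have out: "\<exists>u\<in>F'. u \<notin> \<sigma>" if "card F' = d" for F'
    using card_mono[OF finite_face[OF \<sigma>], of F'] Suc.prems(1) that by force
  obtain u0 where u0: "u0 \<in> F0" "u0 \<notin> \<sigma>" using out Suc.prems(3) by blast
  have S0: "u0 \<in> S" by (rule spread[OF u0(2,1) Suc.prems(2,3,4,5)])
  obtain u where u: "u \<in> F" "u \<notin> \<sigma>" using out Suc.prems(7) by blast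
  have "u \<in> S"
  proof (rule link_connected[OF \<sigma>, of S u])
    show "Suc (card \<sigma>) < d" using Suc.prems(1) by simp
    show "S \<noteq> {}" using S0 by blast
    show "x \<notin> \<sigma> \<and> face (insert x \<sigma>)" if "x \<in> S" for x
      using that by (simp add: S_def link_def)
    show "u \<notin> \<sigma>" by (rule u(2))
    show "face (insert u \<sigma>)" by (rule face_subset[OF Suc.prems(6)]) (use u Suc.prems(8) in auto)
    show "w' \<in> S" if x: "x \<in> S" and w': "w' \<notin> insert x \<sigma>" "face (insert w' (insert x \<sigma>))" for x w'
    proof -
      obtain F1 where F1: "insert w' (insert x \<sigma>) \<subseteq> F1" "face F1" "card F1 = d"
        using face_in_facet[OF w'(2)] .
      have "a s = 0" if "s \<in> F1" for s
        using x F1 that unfolding S_def by blast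
      then show ?thesis using spread[of w' F1] F1 w'(1) by blast
    qed
  qed
  then show ?case using Suc.prems(6-9) u(1) unfolding S_def by blast
qed

text \<open>The star of the empty face is the whole boundary, so this is \<open>star_rigid\<close> for \<open>\<sigma> = {}\<close>.\<close>

theorem simplicial_rigidity:
  assumes d: "d \<ge> 3" and flex: "flex a"
    and tangent: "\<And>v z t. v \<in> V \<Longrightarrow> z \<in> affine hull V \<Longrightarrow> z + t *\<^sub>R a v \<in> affine hull V"
    and F0: "face F0" "card F0 = d" and a0: "\<And>s. s \<in> F0 \<Longrightarrow> a s = 0"
    and v: "face {v}"
  shows "a v = 0"
proof -
  obtain F where F: "{v} \<subseteq> F" "face F" "card F = d" using face_in_facet[OF v] .
  show ?thesis
    by (rule star_rigid[OF flex tangent _ F0 _ a0 F(2,3), of "{}" "d - 3"]) (use d F in auto)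
qed

end

section \<open>Lower bounds for dimensions of spaces of vector fields\<close>

text \<open>Linear algebra in the space of all functions into a vector space, with pointwise operations.\<close>

definition fun_subspace :: "('c \<Rightarrow> 'b::real_vector) set \<Rightarrow> bool" where
  "fun_subspace S \<longleftrightarrow> (\<lambda>x. 0) \<in> S \<and> (\<forall>f\<in>S. \<forall>g\<in>S. \<forall>r. (\<lambda>x. f x + r *\<^sub>R g x) \<in> S)"

definition fun_functional :: "(('c \<Rightarrow> 'b::real_vector) \<Rightarrow> real) \<Rightarrow> bool" where
  "fun_functional \<phi> \<longleftrightarrow> (\<forall>f g r. \<phi> (\<lambda>x. f x + r *\<^sub>R g x) = \<phi> f + r * \<phi> g)"

definition independent_family :: "nat set \<Rightarrow> (nat \<Rightarrow> 'c \<Rightarrow> 'b::real_vector) \<Rightarrow> bool" where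
  "independent_family I g \<longleftrightarrow> (\<forall>c. (\<forall>x. (\<Sum>i\<in>I. c i *\<^sub>R g i x) = 0) \<longrightarrow> (\<forall>i\<in>I. c i = 0))"

lemma independent_familyD:
  "independent_family I g \<Longrightarrow> (\<And>x. (\<Sum>i\<in>I. c i *\<^sub>R g i x) = 0) \<Longrightarrow> i \<in> I \<Longrightarrow> c i = 0"
  unfolding independent_family_def by simp

text \<open>Only lower bounds for dimensions are counted, so it suffices to exhibit independent families.
  Index sets are arbitrary finite sets of numbers because families get restricted and joined.\<close>

definition dim_at_least :: "('c \<Rightarrow> 'b::real_vector) set \<Rightarrow> nat \<Rightarrow> bool" where
  "dim_at_least S n \<longleftrightarrow>
     (\<exists>I g. finite I \<and> card I = n \<and> (\<forall>i\<in>I. g i \<in> S) \<and> independent_family I g)"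

lemma dim_at_leastE:
  assumes "dim_at_least S n"
  obtains I :: "nat set" and g where "finite I" "card I = n" "\<And>i. i \<in> I \<Longrightarrow> g i \<in> S"
    "independent_family I g"
  using assms unfolding dim_at_least_def by auto

lemma dim_at_leastI:
  fixes I :: "nat set"
  assumes "finite I" "\<And>i. i \<in> I \<Longrightarrow> g i \<in> S"
    "\<And>c i. (\<And>x. (\<Sum>i\<in>I. c i *\<^sub>R g i x) = 0) \<Longrightarrow> i \<in> I \<Longrightarrow> c i = 0"
  shows "dim_at_least S (card I)"
  unfolding dim_at_least_def independent_family_def using assms
  by (intro exI[of _ I] exI[of _ g] conjI refl ballI allI impI) simp_all

lemma dim_at_least_0: "dim_at_least S 0"
  using dim_at_leastI[of "{}" "\<lambda>_. undefined" S] by simp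

lemma dim_at_least_mono:
  assumes "dim_at_least S n" "S \<subseteq> T" "m \<le> n"
  shows "dim_at_least T m"
proof -
  obtain I :: "nat set" and g where g: "finite I" "card I = n" "\<And>i. i \<in> I \<Longrightarrow> g i \<in> S"
    "independent_family I g"
    using dim_at_leastE[OF assms(1)] by blast
  obtain J where J: "J \<subseteq> I" "card J = m"
    using obtain_subset_with_card_n[of m I] g(2) assms(3) by blast
  have "dim_at_least T (card J)"
  proof (rule dim_at_leastI)
    show "finite J" using J(1) g(1) finite_subset by blast
    show "g i \<in> T" if "i \<in> J" for i using g(3) J(1) assms(2) that by blast
    show "c i = 0" if c: "\<And>x. (\<Sum>i\<in>J. c i *\<^sub>R g i x) = 0" and i: "i \<in> J" for c i
    proof -
      define c' where "c' i = (if i \<in> J then c i else 0)" for i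
      have "(\<Sum>i\<in>I. c' i *\<^sub>R g i x) = (\<Sum>i\<in>J. c i *\<^sub>R g i x)" for x
        by (rule sum.mono_neutral_cong_right) (use g(1) J(1) in \<open>auto simp: c'_def\<close>)
      then have "c' i = 0" using c i J(1) by (intro independent_familyD[OF g(4), of c']) auto
      then show ?thesis using i by (simp add: c'_def)
    qed
  qed
  then show ?thesis using J(2) by simp
qed

lemma dim_at_least_nonzero:
  assumes "dim_at_least S (Suc n)"
  shows "\<exists>f\<in>S. \<exists>x. f x \<noteq> 0"
proof -
  obtain I :: "nat set" and g where g: "finite I" "card I = Suc n" "\<And>i. i \<in> I \<Longrightarrow> g i \<in> S"
    "independent_family I g"
    using dim_at_leastE[OF assms] by blast
  obtain i where i: "i \<in> I" using g(2) by fastforce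
  have "\<exists>x. g i x \<noteq> 0"
  proof (rule ccontr)
    assume "\<not> ?thesis"
    then have z: "\<And>x. g i x = 0" by blast
    have "(\<Sum>j\<in>I. (if j = i then 1 else 0::real) *\<^sub>R g j x) = 0" for x
      by (rule sum.neutral) (simp add: z)
    from independent_familyD[OF g(4) this i] show False by simp
  qed
  then show ?thesis using g(3)[OF i] by blast
qed

lemma fun_subspace_sum:
  assumes S: "fun_subspace S" and "finite I" "\<And>i. i \<in> I \<Longrightarrow> g i \<in> S"
  shows "(\<lambda>x. \<Sum>i\<in>I. c i *\<^sub>R g i x) \<in> S"
  using assms(2,3)
proof (induction I)
  case empty
  then show ?case using S by (simp add: fun_subspace_def)
next
  case (insert i I)
  have "(\<lambda>x. (\<Sum>i\<in>I. c i *\<^sub>R g i x) + c i *\<^sub>R g i x) \<in> S"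
    using S insert by (simp add: fun_subspace_def)
  then show ?case using insert(1,2) by (simp add: add.commute)
qed

text \<open>The index set of the second family is shifted beyond that of the first, so that both families can
  be joined into one.\<close>

lemma dim_at_least_direct_sum:
  assumes S: "fun_subspace S" "dim_at_least S m" and R: "fun_subspace R" "dim_at_least R n"
    and Q: "S \<subseteq> Q" "R \<subseteq> Q"
    and disj: "\<And>f g x. f \<in> S \<Longrightarrow> g \<in> R \<Longrightarrow> (\<And>x. f x + g x = 0) \<Longrightarrow> f x = 0"
  shows "dim_at_least Q (m + n)"
proof -
  obtain I :: "nat set" and g where g: "finite I" "card I = m" "\<And>i. i \<in> I \<Longrightarrow> g i \<in> S"
    "independent_family I g"
    using dim_at_leastE[OF S(2)] by blast
  obtain J :: "nat set" and h where h: "finite J" "card J = n" "\<And>i. i \<in> J \<Longrightarrow> h i \<in> R"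
    "independent_family J h"
    using dim_at_leastE[OF R(2)] by blast
  \<comment> \<open>the \<open>0\<close> only guards against an empty \<open>I\<close>\<close>
  define k where "k = Suc (Max (insert 0 I))"
  have lt: "i < k" if "i \<in> I" for i
    using that g(1) by (simp add: k_def less_Suc_eq_le)
  define J' where "J' = (+) k ` J"
  define b where "b i = (if i < k then g i else h (i - k))" for i
  have disjoint: "I \<inter> J' = {}" using lt by (fastforce simp: J'_def)
  have fin: "finite (I \<union> J')" using g(1) h(1) by (simp add: J'_def)
  have card: "card (I \<union> J') = m + n"
    using card_Un_disjoint[OF _ _ disjoint] g(1,2) h(1,2) by (simp add: J'_def card_image)
  have split: "(\<Sum>i\<in>I \<union> J'. c i *\<^sub>R b i x) = (\<Sum>i\<in>I. c i *\<^sub>R g i x) + (\<Sum>i\<in>J. c (k + i) *\<^sub>R h i x)" for c x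
  proof -
    have "(\<Sum>i\<in>I \<union> J'. c i *\<^sub>R b i x) = (\<Sum>i\<in>I. c i *\<^sub>R b i x) + (\<Sum>i\<in>J'. c i *\<^sub>R b i x)"
      by (rule sum.union_disjoint) (use g(1) h(1) disjoint in \<open>auto simp: J'_def\<close>)
    also have "(\<Sum>i\<in>I. c i *\<^sub>R b i x) = (\<Sum>i\<in>I. c i *\<^sub>R g i x)"
      by (rule sum.cong) (use lt in \<open>auto simp: b_def\<close>)
    also have "(\<Sum>i\<in>J'. c i *\<^sub>R b i x) = (\<Sum>i\<in>J. c (k + i) *\<^sub>R h i x)"
      unfolding J'_def by (subst sum.reindex) (auto simp: b_def)
    finally show ?thesis .
  qed
  have "dim_at_least Q (card (I \<union> J'))"
  proof (rule dim_at_leastI[OF fin])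
    show "b i \<in> Q" if "i \<in> I \<union> J'" for i
      using that g(3) h(3) Q lt by (auto simp: b_def J'_def)
    show "c i = 0" if c: "\<And>x. (\<Sum>i\<in>I \<union> J'. c i *\<^sub>R b i x) = 0" and i: "i \<in> I \<union> J'" for c i
    proof -
      have sum0: "(\<Sum>i\<in>I. c i *\<^sub>R g i x) + (\<Sum>i\<in>J. c (k + i) *\<^sub>R h i x) = 0" for x
        using c[of x] by (simp only: split)
      have z: "(\<Sum>i\<in>I. c i *\<^sub>R g i x) = 0" for x
        by (rule disj[OF fun_subspace_sum[OF S(1) g(1,3)] fun_subspace_sum[OF R(1) h(1,3)] sum0])
      then have "(\<Sum>i\<in>J. c (k + i) *\<^sub>R h i x) = 0" for x using sum0[of x] by simp
      then have "c (k + j) = 0" if "j \<in> J" for j using independent_familyD[OF h(4), of "\<lambda>i. c (k + i)"] that by simp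
      moreover have "c i = 0" if "i \<in> I" using independent_familyD[OF g(4) z that] .
      ultimately show ?thesis using i by (auto simp: J'_def)
    qed
  qed
  then show ?thesis by (simp add: card)
qed

text \<open>\<open>T\<close> extends each function to points outside \<open>Z\<close>, where it was zero before.  Restricting to \<open>Z\<close>
  recovers the function, so independence survives.\<close>

lemma dim_at_least_extend:
  assumes S: "dim_at_least S n" and T: "\<And>f. f \<in> S \<Longrightarrow> T f \<in> S'"
    and on: "\<And>f y. f \<in> S \<Longrightarrow> y \<in> Z \<Longrightarrow> T f y = f y"
    and off: "\<And>f y. f \<in> S \<Longrightarrow> y \<notin> Z \<Longrightarrow> f y = 0"
  shows "dim_at_least S' n"
proof -
  obtain I :: "nat set" and g where g: "finite I" "card I = n" "\<And>i. i \<in> I \<Longrightarrow> g i \<in> S"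
    "independent_family I g"
    using dim_at_leastE[OF S] by blast
  have "dim_at_least S' (card I)"
  proof (rule dim_at_leastI[OF g(1)])
    show "T (g i) \<in> S'" if "i \<in> I" for i using T g(3) that by blast
    show "c i = 0" if c: "\<And>x. (\<Sum>i\<in>I. c i *\<^sub>R T (g i) x) = 0" and i: "i \<in> I" for c i
    proof (rule independent_familyD[OF g(4) _ i])
      fix x
      show "(\<Sum>i\<in>I. c i *\<^sub>R g i x) = 0"
      proof (cases "x \<in> Z")
        case True
        then have "(\<Sum>i\<in>I. c i *\<^sub>R g i x) = (\<Sum>i\<in>I. c i *\<^sub>R T (g i) x)"
          using on g(3) by (intro sum.cong) auto
        then show ?thesis using c by simp
      next
        case False
        then show ?thesis using off g(3) by (intro sum.neutral) auto
      qed
    qed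
  qed
  then show ?thesis by (simp add: g(2))
qed

text \<open>One step of Gaussian elimination, with a family member \<open>g a\<close> on which \<open>\<phi>\<close> does not vanish as pivot.\<close>

lemma dim_at_least_kernel:
  assumes S: "fun_subspace S" "dim_at_least S n" and \<phi>: "fun_functional \<phi>"
  shows "dim_at_least {f \<in> S. \<phi> f = 0} (n - 1)"
proof -
  obtain I :: "nat set" and g where g: "finite I" "card I = n" "\<And>i. i \<in> I \<Longrightarrow> g i \<in> S"
    "independent_family I g"
    using dim_at_leastE[OF S(2)] by blast
  show ?thesis
  proof (cases "\<forall>i\<in>I. \<phi> (g i) = 0")
    case True
    have "dim_at_least {f \<in> S. \<phi> f = 0} (card I)"
      unfolding dim_at_least_def using True g by (intro exI[of _ I] exI[of _ g]) auto
    then show ?thesis using dim_at_least_mono g(2) by (metis diff_le_self order_refl)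
  next
    case False
    then obtain a where a: "a \<in> I" "\<phi> (g a) \<noteq> 0" by blast
    define r where "r i = - \<phi> (g i) / \<phi> (g a)" for i
    have "dim_at_least {f \<in> S. \<phi> f = 0} (card (I - {a}))"
    proof (rule dim_at_leastI)
      show "finite (I - {a})" using g(1) by simp
      show "(\<lambda>x. g i x + r i *\<^sub>R g a x) \<in> {f \<in> S. \<phi> f = 0}" if "i \<in> I - {a}" for i
      proof -
        have "g i \<in> S" "g a \<in> S" using that a(1) g(3) by auto
        then have "(\<lambda>x. g i x + r i *\<^sub>R g a x) \<in> S"
          using S(1) unfolding fun_subspace_def by blast
        moreover have "\<phi> (\<lambda>x. g i x + r i *\<^sub>R g a x) = \<phi> (g i) + r i * \<phi> (g a)"
          using \<phi> unfolding fun_functional_def by blast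
        ultimately show ?thesis using a(2) by (simp add: r_def)
      qed
      show "c i = 0" if c: "\<And>x. (\<Sum>i\<in>I - {a}. c i *\<^sub>R (g i x + r i *\<^sub>R g a x)) = 0"
        and i: "i \<in> I - {a}" for c i
      proof -
        define c' where "c' = c(a := \<Sum>i\<in>I - {a}. c i * r i)"
        have "(\<Sum>i\<in>I. c' i *\<^sub>R g i x) = 0" for x
        proof -
          have "(\<Sum>i\<in>I. c' i *\<^sub>R g i x) = c' a *\<^sub>R g a x + (\<Sum>i\<in>I - {a}. c' i *\<^sub>R g i x)"
            by (rule sum.remove[OF g(1) a(1)])
          also have "(\<Sum>i\<in>I - {a}. c' i *\<^sub>R g i x) = (\<Sum>i\<in>I - {a}. c i *\<^sub>R g i x)"
            by (rule sum.cong) (auto simp: c'_def)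
          also have "c' a *\<^sub>R g a x + \<dots> = (\<Sum>i\<in>I - {a}. c i *\<^sub>R (g i x + r i *\<^sub>R g a x))"
            by (simp add: c'_def scaleR_sum_left scaleR_add_right sum.distrib)
          finally show ?thesis using c by simp
        qed
        from independent_familyD[OF g(4) this, of i] show ?thesis using i by (auto simp: c'_def)
      qed
    qed
    then show ?thesis using a(1) g(1,2) by simp
  qed
qed

lemma fun_subspace_kernel:
  assumes "fun_subspace S" "fun_functional \<phi>"
  shows "fun_subspace {f \<in> S. \<phi> f = 0}"
proof -
  have "\<phi> (\<lambda>x. (\<lambda>x. 0) x + 1 *\<^sub>R (\<lambda>x. 0) x) = \<phi> (\<lambda>x. 0) + 1 * \<phi> (\<lambda>x. 0)"
    by (rule assms(2)[unfolded fun_functional_def, rule_format])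
  then have "\<phi> (\<lambda>x. 0) = 0" by simp
  then show ?thesis
    using assms unfolding fun_subspace_def fun_functional_def by simp
qed

lemma dim_at_least_kernels:
  assumes S: "fun_subspace S" "dim_at_least S n" and J: "finite J" "\<And>j. j \<in> J \<Longrightarrow> fun_functional (\<phi> j)"
  shows "fun_subspace {f \<in> S. \<forall>j\<in>J. \<phi> j f = 0} \<and>
    dim_at_least {f \<in> S. \<forall>j\<in>J. \<phi> j f = 0} (n - card J)"
  using J
proof (induction J)
  case empty
  then show ?case using S by simp
next
  case (insert j J)
  have eq: "{f \<in> S. \<forall>i\<in>insert j J. \<phi> i f = 0} = {f \<in> {f \<in> S. \<forall>i\<in>J. \<phi> i f = 0}. \<phi> j f = 0}"
    by auto
  have IH: "fun_subspace {f \<in> S. \<forall>i\<in>J. \<phi> i f = 0}"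
    "dim_at_least {f \<in> S. \<forall>i\<in>J. \<phi> i f = 0} (n - card J)"
    using insert by auto
  have "n - card (insert j J) = n - card J - 1" using insert by simp
  then show ?case
    unfolding eq using fun_subspace_kernel[OF IH(1)] dim_at_least_kernel[OF IH] insert(4) by simp
qed

section \<open>Velocities that keep distances to first order\<close>

text \<open>The inner product is half the derivative of the squared distance of \<open>u\<close> and \<open>w\<close>.  Fields vanish
  outside \<open>X\<close> so that they are determined by finitely many values.\<close>

definition velocities :: "'a::euclidean_space set \<Rightarrow> 'a set \<Rightarrow> ('a \<times> 'a) set \<Rightarrow> ('a \<Rightarrow> 'a) set" where
  "velocities L X E = {a. (\<forall>x. a x \<in> L) \<and> (\<forall>x. x \<notin> X \<longrightarrow> a x = 0) \<and>
     (\<forall>(u, w)\<in>E. (a u - a w) \<bullet> (u - w) = 0)}"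

lemma fun_functional_inner: "fun_functional (\<lambda>a. a x \<bullet> t)"
  by (simp add: fun_functional_def inner_add_left)

lemma fun_functional_edge: "fun_functional (\<lambda>a. (a u - a w) \<bullet> t)"
  by (simp add: fun_functional_def inner_diff_left inner_add_left algebra_simps)

lemma fun_subspace_velocities:
  assumes "subspace L"
  shows "fun_subspace (velocities L X E)"
proof -
  have "(f u + r *\<^sub>R g u - (f w + r *\<^sub>R g w)) \<bullet> (u - w) = (f u - f w) \<bullet> (u - w) + r * ((g u - g w) \<bullet> (u - w))"
    for f g :: "'a \<Rightarrow> 'a" and u w r
    by (simp add: inner_diff_left inner_add_left algebra_simps)
  then show ?thesis
    using assms unfolding fun_subspace_def velocities_def
    by (fastforce simp: subspace_0 subspace_add subspace_scale)
qed

lemma velocities_at_point: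
  fixes L :: "'a::euclidean_space set"
  assumes "subspace L"
  shows "dim_at_least (velocities L {x} {}) (dim L)"
proof -
  obtain B where B: "B \<subseteq> L" "independent B" "card B = dim L"
    using basis_exists[of L] by metis
  have "finite B" using B(2) independent_imp_finite by blast
  then obtain e where e: "bij_betw e {0..<dim L} B"
    using ex_bij_betw_nat_finite B(3) by metis
  have "dim_at_least (velocities L {x} {}) (card {0..<dim L})"
  proof (rule dim_at_leastI)
    show "(\<lambda>y. if y = x then e i else 0) \<in> velocities L {x} {}" if "i \<in> {0..<dim L}" for i
      using that e B(1) subspace_0[OF assms] by (auto simp: velocities_def bij_betw_def)
    show "c i = 0" if c: "\<And>y. (\<Sum>i\<in>{0..<dim L}. c i *\<^sub>R (if y = x then e i else 0)) = 0"
      and i: "i \<in> {0..<dim L}" for c i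
    proof -
      define c' where "c' b = c (the_inv_into {0..<dim L} e b)" for b
      have inv: "c' (e j) = c j" if "j \<in> {0..<dim L}" for j
        using the_inv_into_f_f[of e "{0..<dim L}" j] e that by (simp add: c'_def bij_betw_def)
      have "(\<Sum>b\<in>B. c' b *\<^sub>R b) = (\<Sum>j\<in>{0..<dim L}. c' (e j) *\<^sub>R e j)"
        by (rule sum.reindex_bij_betw[OF e, symmetric])
      also have "\<dots> = (\<Sum>j\<in>{0..<dim L}. c j *\<^sub>R e j)"
        using inv by (intro sum.cong) auto
      also have "\<dots> = 0" using c[of x] by simp
      finally have "c' b = 0" if "b \<in> B" for b
        using independentD[OF B(2) \<open>finite B\<close> order_refl _ that] by simp
      moreover have "e i \<in> B" using e i by (auto simp: bij_betw_def)
      ultimately show ?thesis using inv[OF i] by metis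
    qed
  qed simp
  then show ?thesis by simp
qed

text \<open>A new point contributes \<open>dim L\<close> degrees of freedom and one equation for each old point.\<close>

lemma velocities_insert_vertex:
  fixes L :: "'a::euclidean_space set"
  assumes L: "subspace L" and X: "finite X" "x \<notin> X"
    and n: "dim_at_least (velocities L X (X \<times> X)) n"
  shows "dim_at_least (velocities L (insert x X) (insert x X \<times> insert x X)) (n + dim L - card X)"
proof -
  let ?Q = "velocities L (insert x X) (X \<times> X)"
  note sub = fun_subspace_velocities[OF L]
  have dimQ: "dim_at_least ?Q (n + dim L)"
  proof (rule dim_at_least_direct_sum[OF sub n sub velocities_at_point[OF L, of x]])
    show "velocities L X (X \<times> X) \<subseteq> ?Q"
      by (auto simp: velocities_def)
    show "velocities L {x} {} \<subseteq> ?Q"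
    proof
      fix a assume a: "a \<in> velocities L {x} {}"
      then have "a u = 0" if "u \<in> X" for u
        using that X(2) by (auto simp: velocities_def)
      then show "a \<in> ?Q" using a by (auto simp: velocities_def)
    qed
    show "f y = 0" if "f \<in> velocities L X (X \<times> X)" "g \<in> velocities L {x} {}" "\<And>y. f y + g y = 0" for f g y
    proof (cases "y = x")
      case True
      then show ?thesis using that(1) X(2) by (simp add: velocities_def)
    next
      case False
      then show ?thesis using that(2) that(3)[of y] by (simp add: velocities_def)
    qed
  qed
  then have "dim_at_least {a \<in> ?Q. \<forall>y\<in>X. (a x - a y) \<bullet> (x - y) = 0} (n + dim L - card X)"
    using dim_at_least_kernels[OF sub dimQ X(1), of
        "\<lambda>y a. (a x - a y) \<bullet> (x - y)", OF fun_functional_edge] by simp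
  then show ?thesis
  proof (rule dim_at_least_mono)
    show "{a \<in> ?Q. \<forall>y\<in>X. (a x - a y) \<bullet> (x - y) = 0} \<subseteq> velocities L (insert x X) (insert x X \<times> insert x X)"
    proof
      fix a assume a: "a \<in> {a \<in> ?Q. \<forall>y\<in>X. (a x - a y) \<bullet> (x - y) = 0}"
      then have "(a y - a x) \<bullet> (y - x) = 0" if "y \<in> X" for y
        using that by (auto simp: inner_diff_left inner_diff_right)
      then show "a \<in> velocities L (insert x X) (insert x X \<times> insert x X)"
        using a by (auto simp: velocities_def)
    qed
  qed simp
qed

text \<open>The affine extension of a first-order isometry is again one.  Relative to \<open>u\<close>, the numbers
  \<open>p y \<bullet> q y'\<close> are alternating in \<open>y\<close> and \<open>y'\<close>, so their double sum with symmetric coefficients vanishes.\<close>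

lemma rigid_affine_extension:
  fixes a :: "'a::euclidean_space \<Rightarrow> 'a"
  assumes rigid: "\<And>y y'. y \<in> insert u Y \<Longrightarrow> y' \<in> insert u Y \<Longrightarrow> (a y - a y') \<bullet> (y - y') = 0"
    and one: "sum r Y = 1"
  shows "((\<Sum>y\<in>Y. r y *\<^sub>R a y) - a u) \<bullet> ((\<Sum>y\<in>Y. r y *\<^sub>R y) - u) = 0"
proof -
  define p q where "p y = a y - a u" and "q y = y - u" for y
  have p: "(\<Sum>y\<in>Y. r y *\<^sub>R a y) - a u = (\<Sum>y\<in>Y. r y *\<^sub>R p y)"
    using one by (simp add: p_def scaleR_diff_right sum_subtractf flip: scaleR_sum_left)
  have q: "(\<Sum>y\<in>Y. r y *\<^sub>R y) - u = (\<Sum>y\<in>Y. r y *\<^sub>R q y)"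
    using one by (simp add: q_def scaleR_diff_right sum_subtractf flip: scaleR_sum_left)
  have anti: "p y \<bullet> q y' = - (p y' \<bullet> q y)" if "y \<in> Y" "y' \<in> Y" for y y'
  proof -
    have "p y \<bullet> q y = 0" "p y' \<bullet> q y' = 0" using rigid that by (auto simp: p_def q_def)
    moreover have "(p y - p y') \<bullet> (q y - q y') = 0" using rigid that by (auto simp: p_def q_def)
    ultimately show ?thesis by (simp add: inner_diff_left inner_diff_right)
  qed
  let ?s = "(\<Sum>y\<in>Y. r y *\<^sub>R p y) \<bullet> (\<Sum>y\<in>Y. r y *\<^sub>R q y)"
  have "?s = (\<Sum>y\<in>Y. \<Sum>y'\<in>Y. r y * r y' * (p y' \<bullet> q y))"
    by (simp add: inner_sum_left inner_sum_right sum_distrib_left mult.assoc)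
  also have "\<dots> = (\<Sum>y\<in>Y. \<Sum>y'\<in>Y. - (r y' * r y * (p y \<bullet> q y')))"
  proof (intro sum.cong refl)
    fix y y' assume "y \<in> Y" "y' \<in> Y"
    from anti[OF this(2,1)] show "r y * r y' * (p y' \<bullet> q y) = - (r y' * r y * (p y \<bullet> q y'))"
      by simp
  qed
  also have "\<dots> = - (\<Sum>y\<in>Y. \<Sum>y'\<in>Y. r y' * r y * (p y \<bullet> q y'))"
    by (simp add: sum_negf)
  also have "(\<Sum>y\<in>Y. \<Sum>y'\<in>Y. r y' * r y * (p y \<bullet> q y')) = (\<Sum>y'\<in>Y. \<Sum>y\<in>Y. r y' * r y * (p y \<bullet> q y'))"
    by (rule sum.swap)
  also have "\<dots> = ?s"
    by (simp add: inner_sum_left inner_sum_right sum_distrib_left mult.assoc)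
  finally show ?thesis unfolding p q by simp
qed

text \<open>A new point in the affine hull of \<open>Y\<close> costs no degree of freedom, since every velocity field
  extends affinely to it.  In addition it may move orthogonally to the affine hull.  This gain is
  what makes up for the degenerate position of the points.\<close>

lemma velocities_insert_dependent:
  fixes L :: "'a::euclidean_space set"
  assumes L: "subspace L" and Y: "finite Y" "Y \<noteq> {}" "Y \<subseteq> X"
    and X: "X \<subseteq> affine hull Y" "x \<notin> X" "x \<in> affine hull Y"
    and n: "dim_at_least (velocities L X (X \<times> X)) n"
  shows "dim_at_least (velocities L (insert x X) (insert x X \<times> insert x X)) (n + (dim L + 1 - card Y))"
proof -
  let ?Q = "velocities L (insert x X) (insert x X \<times> insert x X)"
  obtain r where r: "sum r Y = 1" "(\<Sum>y\<in>Y. r y *\<^sub>R y) = x"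
    using X(3) unfolding affine_hull_finite[OF Y(1)] by blast
  define S where "S = {a \<in> ?Q. a x = (\<Sum>y\<in>Y. r y *\<^sub>R a y)}"
  have S: "fun_subspace S"
  proof -
    have "(\<lambda>y. f y + t *\<^sub>R g y) \<in> S" if "f \<in> S" "g \<in> S" for f g t
    proof -
      have "f x + t *\<^sub>R g x = (\<Sum>y\<in>Y. r y *\<^sub>R (f y + t *\<^sub>R g y))"
        using that by (simp add: S_def scaleR_add_right sum.distrib scaleR_sum_right mult.commute)
      then show ?thesis
        using that fun_subspace_velocities[OF L] unfolding S_def fun_subspace_def by simp
    qed
    moreover have "(\<lambda>y. 0) \<in> S"
      using fun_subspace_velocities[OF L] unfolding S_def fun_subspace_def by simp
    ultimately show ?thesis unfolding fun_subspace_def by blast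
  qed
  have dimS: "dim_at_least S n"
  proof (rule dim_at_least_extend[OF n, where T = "\<lambda>a. a(x := \<Sum>y\<in>Y. r y *\<^sub>R a y)" and Z = "- {x}"])
    fix a assume a: "a \<in> velocities L X (X \<times> X)"
    let ?a = "a(x := \<Sum>y\<in>Y. r y *\<^sub>R a y)"
    have aX: "(a u - a w) \<bullet> (u - w) = 0" if "u \<in> X" "w \<in> X" for u w
      using a that by (auto simp: velocities_def)
    have ext: "((\<Sum>y\<in>Y. r y *\<^sub>R a y) - a u) \<bullet> (x - u) = 0" if "u \<in> X" for u
      unfolding r(2)[symmetric] by (rule rigid_affine_extension[OF _ r(1)]) (use aX Y(3) that in auto)
    have ext': "(a u - (\<Sum>y\<in>Y. r y *\<^sub>R a y)) \<bullet> (u - x) = 0" if "u \<in> X" for u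
      using ext[OF that] by (simp add: inner_diff_left inner_diff_right)
    have "?a z \<in> L" for z
      using a L by (auto simp: velocities_def intro!: subspace_sum subspace_scale)
    moreover have "?a z = 0" if "z \<notin> insert x X" for z
      using a that by (auto simp: velocities_def)
    moreover have "(?a u - ?a w) \<bullet> (u - w) = 0" if "u \<in> insert x X" "w \<in> insert x X" for u w
      using that ext ext' aX X(2) by auto
    ultimately have "?a \<in> ?Q" unfolding velocities_def by blast
    moreover have "(\<Sum>y\<in>Y. r y *\<^sub>R ?a y) = (\<Sum>y\<in>Y. r y *\<^sub>R a y)"
      using X(2) Y(3) by (intro sum.cong) auto
    ultimately show "?a \<in> S" by (simp add: S_def)
  next
    show "(a(x := \<Sum>y\<in>Y. r y *\<^sub>R a y)) y = a y" if "y \<in> - {x}" for a y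
      using that by simp
    show "a y = 0" if "a \<in> velocities L X (X \<times> X)" "y \<notin> - {x}" for a y
      using that X(2) by (auto simp: velocities_def)
  qed
  obtain y0 where y0: "y0 \<in> Y" using Y(2) by blast
  \<comment> \<open>motions of \<open>x\<close> alone, orthogonal to the affine hull of \<open>Y\<close>\<close>
  define R where "R = {a \<in> velocities L {x} {}. \<forall>y\<in>Y - {y0}. a x \<bullet> (y - y0) = 0}"
  have R: "fun_subspace R" "dim_at_least R (dim L - card (Y - {y0}))"
    using dim_at_least_kernels[OF fun_subspace_velocities[OF L] velocities_at_point[OF L, of x],
        of "Y - {y0}" "\<lambda>y a. a x \<bullet> (y - y0)", OF _ fun_functional_inner] Y(1)
    by (simp_all add: R_def)
  have RQ: "R \<subseteq> ?Q"
  proof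
    fix a assume a: "a \<in> R"
    have ay: "a x \<bullet> (y - y0) = 0" if "y \<in> Y" for y
      using a that by (cases "y = y0") (auto simp: R_def)
    have "a x \<bullet> (u - y0) = 0" if "u \<in> affine hull Y" for u
    proof -
      from that obtain s where s: "sum s Y = 1" "(\<Sum>y\<in>Y. s y *\<^sub>R y) = u"
        unfolding affine_hull_finite[OF Y(1)] by blast
      have "u - y0 = (\<Sum>y\<in>Y. s y *\<^sub>R (y - y0))"
        using s by (simp add: scaleR_diff_right sum_subtractf flip: scaleR_sum_left)
      then show ?thesis using ay by (simp add: inner_sum_right)
    qed
    from this[OF X(3)] this have ax: "a x \<bullet> (x - u) = 0" if "u \<in> affine hull Y" for u
      using that by (simp add: inner_diff_right)
    have a0: "a y = 0" if "y \<noteq> x" for y using a that by (auto simp: R_def velocities_def)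
    have "(a u - a w) \<bullet> (u - w) = 0" if "u \<in> insert x X" "w \<in> insert x X" for u w
    proof -
      have uw: "u \<in> affine hull Y" "w \<in> affine hull Y" using that X by auto
      consider "u = w" | "u = x" "w \<noteq> x" | "u \<noteq> x" "w = x" | "u \<noteq> x" "w \<noteq> x" by blast
      then show ?thesis
      proof cases
        case 2
        then show ?thesis using ax[OF uw(2)] a0[of w] by simp
      next
        case 3
        then show ?thesis using ax[OF uw(1)] a0[of u] by (simp add: inner_diff_right)
      qed (simp_all add: a0)
    qed
    then show "a \<in> ?Q" using a by (auto simp: R_def velocities_def)
  qed
  have "dim_at_least ?Q (n + (dim L - card (Y - {y0})))"
  proof (rule dim_at_least_direct_sum[OF S dimS R _ RQ])
    show "S \<subseteq> ?Q" by (auto simp: S_def)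
    fix f g z assume f: "f \<in> S" and g: "g \<in> R" and fg: "\<And>y. f y + g y = 0"
    have f0: "f y = 0" if "y \<noteq> x" for y
      using fg[of y] g that by (simp add: R_def velocities_def)
    have "f x = (\<Sum>y\<in>Y. r y *\<^sub>R f y)" using f by (simp add: S_def)
    also have "\<dots> = 0"
    proof (rule sum.neutral, rule ballI)
      fix y assume "y \<in> Y"
      then have "y \<noteq> x" using X(2) Y(3) by blast
      then show "r y *\<^sub>R f y = 0" using f0 by simp
    qed
    finally show "f z = 0" using f0 by (cases "z = x") auto
  qed
  moreover have "dim L - card (Y - {y0}) = dim L + 1 - card Y"
  proof -
    have "card Y > 0" using y0 Y(1) card_gt_0_iff by blast
    then show ?thesis using y0 Y(1) by simp
  qed
  ultimately show ?thesis by simp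
qed

lemma rigid_velocities_simplex:
  fixes L :: "'a::euclidean_space set"
  assumes L: "subspace L" and Y: "finite Y" "card Y \<le> dim L + 1"
  shows "dim_at_least (velocities L Y (Y \<times> Y)) (\<Sum>i<card Y. dim L - i)"
  using Y
proof (induction Y)
  case empty
  then show ?case by (simp add: dim_at_least_0)
next
  case (insert x Y)
  have "dim_at_least (velocities L (insert x Y) (insert x Y \<times> insert x Y)) ((\<Sum>i<card Y. dim L - i) + dim L - card Y)"
    by (rule velocities_insert_vertex[OF L insert(1,2)]) (use insert in simp)
  moreover have "(\<Sum>i<card (insert x Y). dim L - i) = (\<Sum>i<card Y. dim L - i) + dim L - card Y"
    using insert by simp
  ultimately show ?case by simp
qed

text \<open>Build up \<open>X\<close> from an affine basis \<open>Y\<close>.  The \<open>i\<close>-th point of the basis adds \<open>dim L - i\<close>, counting from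
  \<open>0\<close>, and each further point adds \<open>dim L + 1 - card Y\<close>, which is at least what is claimed for it.\<close>

lemma rigid_velocities_dim:
  fixes L :: "'a::euclidean_space set"
  assumes L: "subspace L" and X: "finite X" "\<And>u w. u \<in> X \<Longrightarrow> w \<in> X \<Longrightarrow> u - w \<in> L"
  shows "dim_at_least (velocities L X (X \<times> X)) (\<Sum>i<min (dim L) (card X). dim L - i)"
proof (cases "X = {}")
  case True
  then show ?thesis by (simp add: dim_at_least_0)
next
  case False
  obtain Y where Y: "Y \<subseteq> X" "\<not> affine_dependent Y" "affine hull X = affine hull Y"
    using affine_basis_exists[of X] by blast
  have finY: "finite Y" using Y(1) X(1) finite_subset by blast
  have neY: "Y \<noteq> {}" using Y(3) False by auto
  then obtain y0 where y0: "y0 \<in> Y" by blast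
  have "int (card Y) - 1 = aff_dim Y"
    using aff_dim_affine_independent[OF Y(2)] by simp
  also have "\<dots> = int (dim ((+) (- y0) ` Y))"
    by (rule aff_dim_eq_dim) (use y0 in \<open>simp add: hull_inc\<close>)
  also have "\<dots> \<le> int (dim L)"
    using X(2) y0 Y(1) by (intro of_nat_mono dim_subset) force
  finally have cardY: "card Y \<le> dim L + 1" by simp
  define d where "d = dim L"
  have ext: "dim_at_least (velocities L (Y \<union> Z) ((Y \<union> Z) \<times> (Y \<union> Z)))
      ((\<Sum>i<card Y. d - i) + card Z * (d + 1 - card Y))"
    if "finite Z" "Z \<subseteq> X - Y" for Z
    using that
  proof (induction Z)
    case empty
    then show ?case using rigid_velocities_simplex[OF L finY cardY] by (simp add: d_def)
  next
    case (insert x Z)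
    have hull: "X \<subseteq> affine hull Y" using Y(3) hull_subset[of X affine] by simp
    have "dim_at_least (velocities L (insert x (Y \<union> Z)) (insert x (Y \<union> Z) \<times> insert x (Y \<union> Z)))
      ((\<Sum>i<card Y. d - i) + card Z * (d + 1 - card Y) + (dim L + 1 - card Y))"
      by (rule velocities_insert_dependent[OF L finY neY]) (use insert hull Y(1) in auto)
    moreover have "(\<Sum>i<card Y. d - i) + card Z * (d + 1 - card Y) + (dim L + 1 - card Y) =
        (\<Sum>i<card Y. d - i) + card (insert x Z) * (d + 1 - card Y)"
      using insert(1,2) by (simp add: d_def)
    ultimately show ?case by (simp only: Un_insert_right)
  qed
  have "dim_at_least (velocities L X (X \<times> X)) ((\<Sum>i<card Y. d - i) + card (X - Y) * (d + 1 - card Y))"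
    using ext[of "X - Y"] X(1) Y(1) by (simp add: Un_absorb1)
  moreover have "(\<Sum>i<min d (card X). d - i) \<le> (\<Sum>i<card Y. d - i) + card (X - Y) * (d + 1 - card Y)"
  proof (cases "min d (card X) \<le> card Y")
    case True
    then have "(\<Sum>i<min d (card X). d - i) \<le> (\<Sum>i<card Y. d - i)"
      by (intro sum_mono2) auto
    then show ?thesis by simp
  next
    case False
    let ?m = "min d (card X)"
    have "{..<?m} = {..<card Y} \<union> {card Y..<?m}" using False by auto
    then have "(\<Sum>i<?m. d - i) = (\<Sum>i<card Y. d - i) + (\<Sum>i=card Y..<?m. d - i)"
      by (simp add: sum.union_disjoint ivl_disj_int)
    also have "(\<Sum>i=card Y..<?m. d - i) \<le> (\<Sum>i=card Y..<?m. d + 1 - card Y)"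
      by (intro sum_mono) auto
    also have "\<dots> \<le> card (X - Y) * (d + 1 - card Y)"
      using card_Diff_subset[OF finY Y(1)] by (simp add: diff_le_mono)
    finally show ?thesis by simp
  qed
  ultimately show ?thesis
    unfolding d_def using dim_at_least_mono[OF _ order_refl] by blast
qed

text \<open>Pin the vertices one at a time.  If the vertices in \<open>G\<close> are at rest, the velocity of the next vertex
  \<open>u\<close> is orthogonal to the \<open>card G\<close> independent directions towards them, so \<open>dim L - card G\<close> further
  equations, from completing these directions to a basis of \<open>L\<close>, bring it to rest.\<close>

lemma pin_simplex:
  fixes L :: "'a::euclidean_space set"
  assumes L: "subspace L" and S: "fun_subspace S" "dim_at_least S n"
    and F: "\<not> affine_dependent F" "card F \<le> dim L" "\<And>u w. u \<in> F \<Longrightarrow> w \<in> F \<Longrightarrow> u - w \<in> L"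
    and rigid: "\<And>a. a \<in> S \<Longrightarrow> range a \<subseteq> L"
      "\<And>a u w. a \<in> S \<Longrightarrow> u \<in> F \<Longrightarrow> w \<in> F \<Longrightarrow> (a u - a w) \<bullet> (u - w) = 0"
  shows "dim_at_least {a \<in> S. \<forall>s\<in>F. a s = 0} (n - (\<Sum>i<card F. dim L - i))"
proof -
  have "finite F" using F(1) aff_independent_finite by blast
  moreover have "fun_subspace {a \<in> S. \<forall>s\<in>G. a s = 0} \<and>
      dim_at_least {a \<in> S. \<forall>s\<in>G. a s = 0} (n - (\<Sum>i<card G. dim L - i))"
    if "finite G" "G \<subseteq> F" for G
    using that
  proof (induction G)
    case empty
    then show ?case using S by simp
  next
    case (insert u G)
    let ?S = "{a \<in> S. \<forall>s\<in>G. a s = 0}"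
    let ?D = "(\<lambda>g. - u + g) ` G"
    have "\<not> affine_dependent (insert u G)"
      using affine_independent_subset[OF F(1) insert(4)] .
    then have indep: "independent ?D"
      using affine_dependent_iff_dependent[OF insert(2)] by simp
    have DL: "?D \<subseteq> L" using F(3) insert(4) by force
    obtain B where B: "?D \<subseteq> B" "B \<subseteq> L" "independent B" "L \<subseteq> span B"
      using maximal_independent_subset_extend[OF DL indep] by blast
    have finB: "finite B" using B(3) independent_imp_finite by blast
    have cardB: "card B = dim L" using basis_card_eq_dim[OF B(2,4,3)] by simp
    have "card ?D = card G" by (rule card_image) (simp add: inj_on_def)
    then have card: "card (B - ?D) = dim L - card G"
      using card_Diff_subset[of ?D B] B(1) insert(1) cardB by simp
    have IH: "fun_subspace ?S" "dim_at_least ?S (n - (\<Sum>i<card G. dim L - i))"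
      using insert by auto
    have eq: "{a \<in> ?S. \<forall>t\<in>B - ?D. a u \<bullet> t = 0} = {a \<in> S. \<forall>s\<in>insert u G. a s = 0}"
    proof (intro equalityI subsetI)
      fix a assume a: "a \<in> {a \<in> ?S. \<forall>t\<in>B - ?D. a u \<bullet> t = 0}"
      have "a u \<bullet> t = 0" if t: "t \<in> B" for t
      proof (cases "t \<in> ?D")
        case True
        then obtain g where g: "g \<in> G" "t = - u + g" by blast
        have "(a u - a g) \<bullet> (u - g) = 0" using rigid(2) a g(1) insert(4) by blast
        then show ?thesis using a g by (simp add: inner_diff_right inner_add_right)
      next
        case False
        then show ?thesis using a t by blast
      qed
      then have "orthogonal (a u) t" if "t \<in> span B" for t
        using that orthogonal_to_span[of t B "a u"] by (auto simp: orthogonal_def)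
      moreover have "a u \<in> span B" using rigid(1)[of a] a B(4) by blast
      ultimately have "a u = 0" using orthogonal_self by blast
      then show "a \<in> {a \<in> S. \<forall>s\<in>insert u G. a s = 0}" using a by simp
    qed auto
    have "n - (\<Sum>i<card G. dim L - i) - card (B - ?D) = n - (\<Sum>i<card (insert u G). dim L - i)"
      unfolding card using insert(1,2) by simp
    then show ?case
      using dim_at_least_kernels[OF IH, of "B - ?D" "\<lambda>t a. a u \<bullet> t", OF _ fun_functional_inner] finB
      unfolding eq by simp
  qed
  ultimately show ?thesis by blast
qed

section \<open>Faces of a polytope as exposed vertex sets\<close>

lemma vertices_of_eq: "vertices_of P = {v. v extreme_point_of P}"
  by (simp add: vertices_of_def face_of_singleton)

text \<open>Minkowski's theorem for the face, whose extreme points are the vertices of the polytope in it.\<close>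

lemma polytope_face_hull:
  assumes P: "polytope P" and F: "F face_of P"
  shows "F = convex hull (vertices_of P \<inter> F)"
proof -
  have "polytope F" using P F by (rule face_of_polytope_polytope)
  then have "F = convex hull {x. x extreme_point_of F}"
    using polytope_imp_compact polytope_imp_convex Krein_Milman_Minkowski by blast
  also have "{x. x extreme_point_of F} = vertices_of P \<inter> F"
    using extreme_point_of_face[OF F] by (auto simp: vertices_of_eq)
  finally show ?thesis .
qed

lemma finite_vertices_of: "polytope P \<Longrightarrow> finite (vertices_of P)"
  by (simp add: vertices_of_eq finite_polyhedron_extreme_points polytope_imp_polyhedron)

lemma vertices_of_subset: "vertices_of P \<subseteq> P"
  unfolding vertices_of_def using face_of_imp_subset by blast

lemma polytope_vertices_hull:
  assumes "polytope P"
  shows "P = convex hull (vertices_of P)"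
  using polytope_face_hull[OF assms face_of_refl[OF polytope_imp_convex[OF assms]]]
    vertices_of_subset[of P] by (simp add: Int_absorb2)

lemma face_hull_vertices:
  assumes "convex hull \<tau> face_of P" "\<tau> \<subseteq> vertices_of P"
  shows "vertices_of P \<inter> convex hull \<tau> = \<tau>"
proof
  show "vertices_of P \<inter> convex hull \<tau> \<subseteq> \<tau>"
    using extreme_point_of_face[OF assms(1)] extreme_point_of_convex_hull
    by (auto simp: vertices_of_eq)
  show "\<tau> \<subseteq> vertices_of P \<inter> convex hull \<tau>"
    using assms(2) hull_subset[of \<tau> convex] by blast
qed

text \<open>A functional that is nonnegative on the vertices is nonnegative on the polytope, so it cuts out a
  face, and this face is spanned by the vertices at which the functional vanishes.\<close>

lemma exposed_subset_face:
  assumes P: "polytope P" and \<tau>: "exposed_subset (vertices_of P) \<tau>"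
  shows "\<tau> \<subseteq> vertices_of P" "convex hull \<tau> face_of P" "convex hull \<tau> \<noteq> P"
proof -
  let ?V = "vertices_of P"
  obtain u c v where nonneg: "\<And>v. v \<in> ?V \<Longrightarrow> u \<bullet> v + c \<ge> 0"
    and v: "v \<in> ?V" "u \<bullet> v + c \<noteq> 0" and eq: "\<tau> = {v \<in> ?V. u \<bullet> v + c = 0}"
    using \<tau> unfolding exposed_subset_def affine_functional_def by auto
  show "\<tau> \<subseteq> ?V" using eq by blast
  define F where "F = P \<inter> {x. u \<bullet> x = - c}"
  have "?V \<subseteq> {x. u \<bullet> x \<ge> - c}" using nonneg by force
  then have "convex hull ?V \<subseteq> {x. u \<bullet> x \<ge> - c}"
    by (rule hull_minimal) (rule convex_halfspace_ge)
  then have ge: "x \<in> P \<Longrightarrow> u \<bullet> x \<ge> - c" for x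
    using polytope_vertices_hull[OF P] by blast
  have F: "F face_of P"
    unfolding F_def by (rule face_of_Int_supporting_hyperplane_ge[OF polytope_imp_convex[OF P] ge])
  have "?V \<subseteq> P" by (rule vertices_of_subset)
  then have "?V \<inter> F = \<tau>" by (auto simp: F_def eq)
  then have hull: "convex hull \<tau> = F" using polytope_face_hull[OF P F] by simp
  show "convex hull \<tau> face_of P" using hull F by simp
  have "v \<notin> F" using v(2) by (auto simp: F_def)
  then show "convex hull \<tau> \<noteq> P" using hull v(1) \<open>?V \<subseteq> P\<close> by blast
qed

text \<open>A nonempty proper face has a supporting hyperplane; for the empty face the constant functional \<open>1\<close>
  serves.\<close>

lemma face_exposed_subset:
  assumes P: "polytope P" and \<tau>: "\<tau> \<subseteq> vertices_of P" "convex hull \<tau> face_of P" "convex hull \<tau> \<noteq> P"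
    and ne: "P \<noteq> {}"
  shows "exposed_subset (vertices_of P) \<tau>"
proof -
  let ?V = "vertices_of P"
  have VP: "?V \<subseteq> P" by (rule vertices_of_subset)
  obtain a b where ab: "P \<subseteq> {x. a \<bullet> x \<le> b}" "convex hull \<tau> = P \<inter> {x. a \<bullet> x = b}"
  proof (cases "\<tau> = {}")
    case True
    then show ?thesis using that[of 0 1] by auto
  next
    case False
    then show ?thesis
      using face_of_polytope_iff_supporting_hyperplane[OF P, of "convex hull \<tau>"] \<tau>(2,3) that by auto
  qed
  have aff: "affine_functional (\<lambda>x. (- a) \<bullet> x + b)"
    unfolding affine_functional_def by blast
  have "\<tau> = {v \<in> ?V. (- a) \<bullet> v + b = 0}"
    using face_hull_vertices[OF \<tau>(2,1)] VP unfolding ab(2) by auto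
  moreover have "\<exists>v\<in>?V. (- a) \<bullet> v + b \<noteq> 0"
  proof (rule ccontr)
    assume "\<not> ?thesis"
    then have "?V \<subseteq> convex hull \<tau>" using VP unfolding ab(2) by auto
    then have "convex hull ?V \<subseteq> convex hull \<tau>" by (rule hull_minimal) simp
    then show False
      using polytope_vertices_hull[OF P] face_of_imp_subset[OF \<tau>(2)] \<tau>(3) by blast
  qed
  moreover have "\<forall>v\<in>?V. (- a) \<bullet> v + b \<ge> 0" using ab(1) VP by auto
  ultimately show ?thesis
    unfolding exposed_subset_def using aff by blast
qed

lemma simplicial_points_vertices:
  assumes P: "simplicial_polytope P" and d: "aff_dim P = int d"
  shows "simplicial_points (vertices_of P) d"
proof
  have poly: "polytope P" using P by (simp add: simplicial_polytope_def)
  note V = polytope_vertices_hull[OF poly]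
  have ne: "P \<noteq> {}" using d by auto
  show "finite (vertices_of P)" by (rule finite_vertices_of[OF poly])
  show "aff_dim (vertices_of P) = int d" using d V aff_dim_convex_hull by metis
  fix \<tau> assume \<tau>: "exposed_subset (vertices_of P) \<tau>"
  note f = exposed_subset_face[OF poly \<tau>]
  obtain n where "n simplex (convex hull \<tau>)"
    using P f unfolding simplicial_polytope_def by blast
  then obtain C where C: "\<not> affine_dependent C" "convex hull \<tau> = convex hull C"
    unfolding simplex_def by blast
  have "\<tau> = {x. x extreme_point_of convex hull \<tau>}"
    using face_hull_vertices[OF f(2,1)] extreme_point_of_face[OF f(2)] by (auto simp: vertices_of_eq)
  also have "\<dots> = C"
    unfolding C(2) using extreme_point_of_convex_hull_affine_independent[OF C(1)] by auto
  finally show indep: "\<not> affine_dependent \<tau>" using C(1) by simp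
  fix \<tau>' assume sub: "\<tau>' \<subseteq> \<tau>"
  have "convex hull \<tau>' face_of convex hull \<tau>"
    using face_of_convex_hull_affine_independent[OF indep] sub by blast
  then have face: "convex hull \<tau>' face_of P" using f(2) face_of_trans by blast
  have "convex hull \<tau>' \<noteq> P"
    using hull_mono[OF sub, of convex] face_of_imp_subset[OF f(2)] f(3) by blast
  then show "exposed_subset (vertices_of P) \<tau>'"
    using face_exposed_subset[OF poly _ face _ ne] sub f(1) by blast
qed

section \<open>The bound for the number of two-coloured edges\<close>

lemma sum_descending: "m \<le> d \<Longrightarrow> real (\<Sum>i<m. d - i) = real m * (2 * real d + 1 - real m) / 2"
proof (induction m)
  case (Suc m)
  then show ?case by (simp add: of_nat_diff field_simps)
qed simp

theorem theorem3:
  fixes P :: "'a::euclidean_space set"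
    and V_white V_black :: "'a set"
    and d m :: nat
  assumes "d \<ge> 3"
    and "simplicial_polytope P"
    and "aff_dim P = int d"
    and "V_white \<union> V_black = vertices_of P"
    and "V_white \<inter> V_black = {}"
    and "V_white \<noteq> {}"
    and "V_black \<noteq> {}"
    and "m = min d (card V_white)"
    and "card V_black \<ge> d"
  shows "real (card (edges_between P V_white V_black))
           \<ge> real m * (2 * real d + 1 - real m) / 2"
proof -
  define V where "V = vertices_of P"
  note W = assms(4)[folded V_def]
  have poly: "polytope P" using assms(2) by (simp add: simplicial_polytope_def)
  interpret simplicial_points V d
    unfolding V_def by (rule simplicial_points_vertices[OF assms(2,3)])
  have finW: "finite V_white" and finB: "finite V_black"
    using finite_V W by (metis finite_Un)+
  obtain v0 where v0: "v0 \<in> V" using assms(6) W by blast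
  define L where "L = span ((\<lambda>x. - v0 + x) ` V)"
  have L: "subspace L" by (simp add: L_def)
  have hull: "affine hull V = (\<lambda>x. v0 + x) ` L"
    unfolding L_def by (rule affine_hull_span_gen[OF hull_inc[OF v0]])
  have dimL: "dim L = d"
    using aff_dim_eq_dim[OF hull_inc[OF v0]] aff_dim_V by (simp add: L_def)
  have diffL: "u - w \<in> L" if "u \<in> V" "w \<in> V" for u w
  proof -
    have "(- v0 + u) - (- v0 + w) \<in> L"
      unfolding L_def using that by (intro span_diff span_base) auto
    then show ?thesis by simp
  qed
  have tangent: "z + t *\<^sub>R y \<in> affine hull V" if "y \<in> L" "z \<in> affine hull V" for z t y
  proof -
    from that(2) obtain x where x: "x \<in> L" "z = v0 + x" unfolding hull by blast
    have "x + t *\<^sub>R y \<in> L" using L x(1) that(1) by (simp add: subspace_add subspace_scale)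
    then show ?thesis unfolding hull x(2) by (metis add.assoc image_eqI)
  qed
  have VP: "V \<subseteq> P" unfolding V_def by (rule vertices_of_subset)
  have vertex: "exposed_subset V {v}" if "v \<in> V" for v
  proof -
    have "{v} \<noteq> P" using assms(1,3) by auto
    then show ?thesis
      using face_exposed_subset[OF poly, of "{v}"] that VP unfolding V_def vertices_of_def by auto
  qed
  obtain F0 where F0: "exposed_subset V F0" "card F0 = d"
    using face_in_facet[OF vertex[OF v0]] by blast
  have F0V: "F0 \<subseteq> V" by (rule face_in_V[OF F0(1)])

  \<comment> \<open>the equations are indexed by oriented white-black edges\<close>
  define C where "C = {(u, w). u \<in> V_white \<and> w \<in> V_black \<and> exposed_subset V {u, w}}"
  have finC: "finite C"
    by (rule finite_subset[of _ "V_white \<times> V_black"]) (use finW finB in \<open>auto simp: C_def\<close>)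
  have cardC: "card C \<le> card (edges_between P V_white V_black)"
  proof (rule card_inj_on_le)
    show "inj_on (\<lambda>(u, w). closed_segment u w) C"
    proof (rule inj_onI, clarify)
      fix u w u' w' assume uw: "(u, w) \<in> C" "(u', w') \<in> C" "closed_segment u w = closed_segment u' w'"
      have "{u, w} = {u', w'}"
        using extreme_point_of_segment[of _ u w] extreme_point_of_segment[of _ u' w'] uw(3) by auto
      then show "u = u' \<and> w = w'"
        using uw(1,2) assms(5) by (auto simp: C_def doubleton_eq_iff)
    qed
    show "(\<lambda>(u, w). closed_segment u w) ` C \<subseteq> edges_between P V_white V_black"
    proof clarify
      fix u w assume "(u, w) \<in> C"
      then have uw: "u \<in> V_white" "w \<in> V_black" "exposed_subset V {u, w}" by (auto simp: C_def)
      then have "u \<noteq> w" using assms(5) by blast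
      then have "closed_segment u w edge_of P"
        using exposed_subset_face(2)[OF poly uw(3)[unfolded V_def]]
        by (simp add: edge_of_def segment_convex_hull aff_dim_convex_hull aff_dim_2)
      then show "closed_segment u w \<in> edges_between P V_white V_black"
        using uw unfolding edges_between_def by blast
    qed
    have "edges_between P V_white V_black \<subseteq> (\<lambda>(u, w). closed_segment u w) ` (V_white \<times> V_black)"
      by (auto simp: edges_between_def)
    then show "finite (edges_between P V_white V_black)"
      using finW finB by (meson finite_SigmaI finite_imageI finite_subset)
  qed

  define N where "N k = (\<Sum>i<k. d - i)" for k
  let ?W = "velocities L V_white (V_white \<times> V_white)"
  let ?B = "velocities L V_black (V_black \<times> V_black)"
  \<comment> \<open>white and black vertices move rigidly, but independently of each other\<close>
  let ?Q = "velocities L V (V_white \<times> V_white \<union> V_black \<times> V_black)"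
  note sub = fun_subspace_velocities[OF L]
  have dW: "dim_at_least ?W (N m)"
    using rigid_velocities_dim[OF L finW] diffL W assms(8) by (auto simp: N_def dimL)
  have dB: "dim_at_least ?B (N d)"
    using rigid_velocities_dim[OF L finB] diffL W assms(9) by (auto simp: N_def dimL min_absorb1)
  have dQ: "dim_at_least ?Q (N m + N d)"
  proof (rule dim_at_least_direct_sum[OF sub dW sub dB])
    have zero: "a u = 0" if "a \<in> ?W" "u \<notin> V_white" for a u using that by (simp add: velocities_def)
    have zero': "a u = 0" if "a \<in> ?B" "u \<notin> V_black" for a u using that by (simp add: velocities_def)
    show "?W \<subseteq> ?Q"
    proof
      fix a assume a: "a \<in> ?W"
      have "a u = 0" if "u \<in> V_black" for u using zero[OF a] that assms(5) by blast
      then show "a \<in> ?Q" using a W by (auto simp: velocities_def)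
    qed
    show "?B \<subseteq> ?Q"
    proof
      fix a assume a: "a \<in> ?B"
      have "a u = 0" if "u \<in> V_white" for u using zero'[OF a] that assms(5) by blast
      then show "a \<in> ?Q" using a W by (auto simp: velocities_def)
    qed
    show "f x = 0" if "f \<in> ?W" "g \<in> ?B" "\<And>x. f x + g x = 0" for f g x
    proof (cases "x \<in> V_white")
      case True
      then have "g x = 0" using zero'[OF that(2)] assms(5) by blast
      then show ?thesis using that(3)[of x] by simp
    next
      case False
      then show ?thesis by (rule zero[OF that(1)])
    qed
  qed
  \<comment> \<open>after the white-black edges are added as constraints, every edge of the polytope keeps its length\<close>
  define S where "S = {a \<in> ?Q. \<forall>e\<in>C. (a (fst e) - a (snd e)) \<bullet> (fst e - snd e) = 0}"
  have S: "fun_subspace S" "dim_at_least S (N m + N d - card C)"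
    using dim_at_least_kernels[OF sub dQ finC, of "\<lambda>e a. (a (fst e) - a (snd e)) \<bullet> (fst e - snd e)",
        OF fun_functional_edge] by (simp_all add: S_def)
  have S_L: "a x \<in> L" if "a \<in> S" for a x using that by (simp add: S_def velocities_def)
  have S_flex: "flex a" if "a \<in> S" for a
    unfolding flex_def
  proof (intro allI impI)
    fix u w assume "u \<noteq> w \<and> exposed_subset V {u, w}"
    then have uw: "exposed_subset V {u, w}" "u \<in> V" "w \<in> V" using face_in_V by blast+
    have mixed: "(a x - a y) \<bullet> (x - y) = 0" if "(x, y) \<in> C" for x y
      using \<open>a \<in> S\<close> that by (force simp: S_def)
    consider "(u, w) \<in> V_white \<times> V_white \<union> V_black \<times> V_black" | "(u, w) \<in> C" | "(w, u) \<in> C"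
      using uw W by (auto simp: C_def insert_commute)
    then show "(a u - a w) \<bullet> (u - w) = 0"
    proof cases
      case 1
      then show ?thesis using \<open>a \<in> S\<close> by (auto simp: S_def velocities_def)
    next
      case 2
      then show ?thesis by (rule mixed)
    next
      case 3
      then show ?thesis using mixed[OF 3] by (simp add: inner_diff_left inner_diff_right)
    qed
  qed
  have "dim_at_least {a \<in> S. \<forall>s\<in>F0. a s = 0} (N m + N d - card C - (\<Sum>i<card F0. dim L - i))"
  proof (rule pin_simplex[OF L S face_independent[OF F0(1)]])
    show "card F0 \<le> dim L" by (simp add: F0(2) dimL)
    show "u - w \<in> L" if "u \<in> F0" "w \<in> F0" for u w using diffL that F0V by blast
    show "range a \<subseteq> L" if "a \<in> S" for a using S_L[OF that] by blast
    show "(a u - a w) \<bullet> (u - w) = 0" if "a \<in> S" "u \<in> F0" "w \<in> F0" for a u w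
      using flexD[OF S_flex[OF that(1)] _ F0(1) that(2,3)] by (cases "u = w") auto
  qed
  then have pinned: "dim_at_least {a \<in> S. \<forall>s\<in>F0. a s = 0} (N m - card C)"
    by (simp add: F0(2) dimL N_def algebra_simps)
  have "N m - card C = 0"
  proof (rule ccontr)
    assume "N m - card C \<noteq> 0"
    then obtain k where "N m - card C = Suc k" using not0_implies_Suc by blast
    with pinned have "dim_at_least {a \<in> S. \<forall>s\<in>F0. a s = 0} (Suc k)" by simp
    from dim_at_least_nonzero[OF this]
    obtain a x where a: "a \<in> S" "\<And>s. s \<in> F0 \<Longrightarrow> a s = 0" "a x \<noteq> 0"
      by auto
    then have "x \<in> V" by (auto simp: S_def velocities_def)
    have "a x = 0"
      by (rule simplicial_rigidity[OF assms(1) S_flex[OF a(1)] tangent[OF S_L[OF a(1)]] F0 a(2) vertex[OF \<open>x \<in> V\<close>]])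
    then show False using a(3) by simp
  qed
  then have "real (N m) \<le> real (card (edges_between P V_white V_black))"
    using cardC by simp
  moreover have "real (N m) = real m * (2 * real d + 1 - real m) / 2"
    unfolding N_def by (rule sum_descending) (simp add: assms(8))
  ultimately show ?thesis by simp
qed

end
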